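(* Let $s\in(0,1)$, $N>2s$, $2^*=\frac{2N}{N-2s}$, $q>p\ge 2^*-1$, and let $\Omega\subset\mathbb{R}^N$ be a bounded domain with smooth boundary. Let $$F(v,\Omega)=\frac12\int_{\mathbb{R}^N}\int_{\mathbb{R}^N}\frac{|v(x)-v(y)|^2}{|x-y|^{N+2s}}\,dx\,dy+\frac1{q+1}\int_{\Omega}|v|^{q+1}\,dx$$ and $$S_\Omega=\inf\Big\{F(v,\Omega): v\in X_0\cap L^{q+1}(\Omega),\ \int_{\Omega}|v|^{p+1}dx=1\Big\}.$$ Then $S_\Omega$ is achieved by a function $u\in X_0\cap L^{q+1}(\Omega)$. Furthermore, there exists a constant $\lambda>0$ such that $u$ satisfies, in the weak sense, $$(-\Delta)^s u=\lambda|u|^{p-1}u-|u|^{q-1}u\ \text{ in }\Omega,\qquad u=0\ \text{ in }\mathbb{R}^N\setminus\Omega. \tag{$*$}$$ Furthermore, if $p\ge 2^*-1$ and $q>(p-1)\frac N{2s}-1$, then $( * )$ admits a positive solution (a weak solution with $u>0$ in $\Omega$). Moreover, for such a positive solution $u$, the scaled function $U=\lambda^{\frac1{p-1}}u$ satisfies $$(-\Delta)^sU=U^p-c^*U^q\ \text{ in }\Omega,\qquad c^*=\lambda^{-\frac{q-1}{p-1}}.$$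
   Context: $X_0=\{v\in H^s(\mathbb{R}^N): v=0\text{ in }\mathbb{R}^N\setminus\Omega\}$, where $H^s(\mathbb{R}^N)$ is the usual fractional Sobolev space. For a nonlinearity $g$, a function $u\in X_0\cap L^{q+1}(\Omega)$ is a weak solution of $(-\Delta)^su=g(u)$ in $\Omega$, $u=0$ in $\mathbb{R}^N\setminus\Omega$, if for every $\varphi\in X_0$ $$\int_{\mathbb{R}^N}\int_{\mathbb{R}^N}\frac{(u(x)-u(y))(\varphi(x)-\varphi(y))}{|x-y|^{N+2s}}\,dx\,dy=\int_\Omega g(u)\varphi\,dx .$$ (Thus the fractional Laplacian here is normalized, up to a constant factor, so that this is its weak form.) *)

theory Defs
  imports "HOL-Analysis.Analysis"
begin

text \<open>
  The space \<open>\<real>\<^sup>N\<close> is an arbitrary Euclidean space \<open>'a\<close> with \<open>N = DIM('a)\<close>. Elements of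
  the function spaces below are Borel representatives of the usual classes modulo Lebesgue-null
  sets; hence pointwise conditions on them are imposed almost everywhere.
\<close>

subsection \<open>Bounded domains with smooth boundary\<close>

primrec Ck_on :: "nat \<Rightarrow> ('a::euclidean_space \<Rightarrow> real) \<Rightarrow> 'a set \<Rightarrow> bool" where
  "Ck_on 0 f U \<longleftrightarrow> continuous_on U f"
| "Ck_on (Suc k) f U \<longleftrightarrow>
     (\<forall>x\<in>U. f differentiable (at x)) \<and>
     (\<forall>b\<in>Basis. Ck_on k (\<lambda>x. frechet_derivative f (at x) b) U)"

definition smooth_fun_on :: "('a::euclidean_space \<Rightarrow> real) \<Rightarrow> 'a set \<Rightarrow> bool" where
  "smooth_fun_on f U \<longleftrightarrow> (\<forall>k. Ck_on k f U)"

text \<open>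
  Near each boundary point the set is the strict sublevel set of a smooth function \<open>\<rho>\<close> without
  critical points; the boundary is then locally the hypersurface \<open>\<rho> = 0\<close>, with the set on one
  side of it.
\<close>

definition smooth_boundary :: "'a::euclidean_space set \<Rightarrow> bool" where
  "smooth_boundary \<Omega> \<longleftrightarrow>
     (\<forall>z\<in>frontier \<Omega>. \<exists>U \<rho>. open U \<and> z \<in> U \<and> smooth_fun_on \<rho> U \<and>
        (\<forall>x\<in>U. \<exists>b\<in>Basis. frechet_derivative \<rho> (at x) b \<noteq> 0) \<and>
        \<Omega> \<inter> U = {x\<in>U. \<rho> x < 0})"

definition smooth_bounded_domain :: "'a::euclidean_space set \<Rightarrow> bool" where
  "smooth_bounded_domain \<Omega> \<longleftrightarrow>
     open \<Omega> \<and> connected \<Omega> \<and> \<Omega> \<noteq> {} \<and> bounded \<Omega> \<and> smooth_boundary \<Omega>"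

subsection \<open>Function spaces\<close>

definition Lspace :: "real \<Rightarrow> 'a::euclidean_space set \<Rightarrow> ('a \<Rightarrow> real) set" where
  "Lspace r \<Omega> = {v. set_borel_measurable lborel \<Omega> v \<and>
                     set_integrable lborel \<Omega> (\<lambda>x. \<bar>v x\<bar> powr r)}"

definition Hs :: "real \<Rightarrow> ('a::euclidean_space \<Rightarrow> real) set" where
  "Hs s = {v. v \<in> borel_measurable lborel \<and>
              integrable lborel (\<lambda>x. \<bar>v x\<bar>\<^sup>2) \<and>
              integrable (lborel \<Otimes>\<^sub>M lborel)
                (\<lambda>(x, y). \<bar>v x - v y\<bar>\<^sup>2 / norm (x - y) powr (real DIM('a) + 2 * s))}"

definition X0 :: "real \<Rightarrow> 'a::euclidean_space set \<Rightarrow> ('a \<Rightarrow> real) set" where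
  "X0 s \<Omega> = {v \<in> Hs s. AE x in lborel. x \<notin> \<Omega> \<longrightarrow> v x = 0}"

subsection \<open>Weak solutions\<close>

definition gagliardo_form ::
    "real \<Rightarrow> ('a::euclidean_space \<Rightarrow> real) \<Rightarrow> ('a \<Rightarrow> real) \<Rightarrow> real" where
  "gagliardo_form s u \<phi> =
     (\<integral>(x, y). (u x - u y) * (\<phi> x - \<phi> y) / norm (x - y) powr (real DIM('a) + 2 * s)
        \<partial>(lborel \<Otimes>\<^sub>M lborel))"

text \<open>
  Integrability of \<open>g(u) \<phi>\<close> is part of the definition because the Bochner integral is \<open>0\<close> on
  functions that are not integrable. The integrand of \<open>gagliardo_form s u \<phi>\<close> is always integrable
  for \<open>u\<close> and \<open>\<phi>\<close> in \<open>X0 s \<Omega>\<close>.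
\<close>

definition weak_solution ::
    "real \<Rightarrow> real \<Rightarrow> 'a::euclidean_space set \<Rightarrow> (real \<Rightarrow> real) \<Rightarrow> ('a \<Rightarrow> real) \<Rightarrow> bool" where
  "weak_solution s q \<Omega> g u \<longleftrightarrow>
     u \<in> X0 s \<Omega> \<inter> Lspace (q + 1) \<Omega> \<and>
     (\<forall>\<phi>\<in>X0 s \<Omega>.
        set_integrable lborel \<Omega> (\<lambda>x. g (u x) * \<phi> x) \<and>
        gagliardo_form s u \<phi> = (LINT x:\<Omega>|lborel. g (u x) * \<phi> x))"

definition positive_weak_solution ::
    "real \<Rightarrow> real \<Rightarrow> 'a::euclidean_space set \<Rightarrow> (real \<Rightarrow> real) \<Rightarrow> ('a \<Rightarrow> real) \<Rightarrow> bool" where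
  "positive_weak_solution s q \<Omega> g u \<longleftrightarrow>
     weak_solution s q \<Omega> g u \<and> (AE x in lborel. x \<in> \<Omega> \<longrightarrow> u x > 0)"

subsection \<open>The variational problem\<close>

definition crit_exp :: "nat \<Rightarrow> real \<Rightarrow> real" where
  "crit_exp N s = 2 * real N / (real N - 2 * s)"

definition energy :: "real \<Rightarrow> real \<Rightarrow> ('a::euclidean_space \<Rightarrow> real) \<Rightarrow> 'a set \<Rightarrow> real" where
  "energy s q v \<Omega> =
     1 / 2 * (\<integral>(x, y). \<bar>v x - v y\<bar>\<^sup>2 / norm (x - y) powr (real DIM('a) + 2 * s)
                \<partial>(lborel \<Otimes>\<^sub>M lborel)) +
     1 / (q + 1) * (LINT x:\<Omega>|lborel. \<bar>v x\<bar> powr (q + 1))"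

definition admissible ::
    "real \<Rightarrow> real \<Rightarrow> real \<Rightarrow> 'a::euclidean_space set \<Rightarrow> ('a \<Rightarrow> real) set" where
  "admissible s p q \<Omega> =
     {v \<in> X0 s \<Omega> \<inter> Lspace (q + 1) \<Omega>. (LINT x:\<Omega>|lborel. \<bar>v x\<bar> powr (p + 1)) = 1}"

definition S_inf :: "real \<Rightarrow> real \<Rightarrow> real \<Rightarrow> 'a::euclidean_space set \<Rightarrow> real" where
  "S_inf s p q \<Omega> = (INF v\<in>admissible s p q \<Omega>. energy s q v \<Omega>)"

definition nonlin :: "real \<Rightarrow> real \<Rightarrow> real \<Rightarrow> real \<Rightarrow> real" where
  "nonlin p q lam t = lam * \<bar>t\<bar> powr (p - 1) * t - \<bar>t\<bar> powr (q - 1) * t"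

end

theory Submission
  imports Defs "HOL-Complex_Analysis.Great_Picard"
begin

text \<open>
  A minimizing sequence is bounded in the Gagliardo seminorm and in \<open>L\<^bsup>q+1\<^esup>\<close>. Comparing a function
  with its means against a tent kernel of width \<open>h\<close> costs only a power of \<open>h\<close> times the seminorm,
  so the sequence has a subsequence converging almost everywhere; as \<open>p < q\<close> and the domain has
  finite measure, the constraint passes to the limit, and Fatou's lemma gives a minimizer, which
  may be taken nonnegative. Its Euler--Lagrange equation holds for test functions in
  \<open>X\<^sub>0 \<inter> L\<^bsup>q+1\<^esup>\<close>. Testing with \<open>(u - K)\<^sup>+\<close> for \<open>K = \<lambda>\<^bsup>1/(q-p)\<^esup>\<close>, the positive zero of the
    nonlinearity,
  shows \<open>u \<le> K\<close>. Hence the equation extends to all test functions in \<open>X\<^sub>0\<close>, and \<open>u\<close> is a nonnegative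
  supersolution of the fractional Laplacian, thus positive by the strong maximum principle. No
  Sobolev embedding is involved.
\<close>

section \<open>The Gagliardo form and the space \<open>X\<^sub>0\<close>\<close>

text \<open>At and above the critical exponent the seminorm gives no compactness in L^{p+1}, and a
  function of X0 need not lie in L^{q+1}. Hence a variation \<open>u + t * \<phi>\<close> has finite
  energy only for \<phi> in the intersection, while a weak solution must be tested with all of X0.
  The bound on u is what closes this gap, since it makes the right-hand side bounded. The constraint
  is handled by division rather than by a multiplier theorem: the energy of
  \<open>u + t * \<phi>\<close> divided by its L^{p+1} norm is a function of one real variable. Its
  derivative at 0 produces \<lambda> as the form at u plus the integral of |u|^{q+1}, the same value
  that testing with u itself would force. In the maximum principle \<open>\<psi> n (u x)\<close>
  alone is no test function, because it equals 1 wherever u vanishes, in particular off \<Omega>.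
  The factor \<eta>, the distance to the complement, restores the exterior condition and is positive
  exactly in \<Omega>. The same distance function shows that the constraint set is nonempty. A
  single nonnegative minimizer serves both as u and as the positive solution.\<close>

definition gker ::
    "real \<Rightarrow> ('a::euclidean_space \<Rightarrow> real) \<Rightarrow> ('a \<Rightarrow> real) \<Rightarrow> 'a \<times> 'a \<Rightarrow> real" where
  "gker s u v = (\<lambda>(x, y). (u x - u y) * (v x - v y) / norm (x - y) powr (real DIM('a) + 2 * s))"

lemma gagliardo_form_gker: "gagliardo_form s u v = integral\<^sup>L (lborel \<Otimes>\<^sub>M lborel) (gker s u v)"
  by (simp add: gagliardo_form_def gker_def)

lemma gker_measurable [measurable]:
  fixes u v :: "'a::euclidean_space \<Rightarrow> real"
  assumes [measurable]: "u \<in> borel_measurable lborel" "v \<in> borel_measurable lborel"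
  shows "gker s u v \<in> borel_measurable (lborel \<Otimes>\<^sub>M lborel)"
  unfolding gker_def case_prod_beta by measurable

lemma gker_nonneg: "0 \<le> gker s v v z"
  by (auto simp: gker_def split: prod.splits)

lemma Hs_iff:
  "v \<in> Hs s \<longleftrightarrow> v \<in> borel_measurable lborel \<and> integrable lborel (\<lambda>x. (v x)\<^sup>2) \<and>
     integrable (lborel \<Otimes>\<^sub>M lborel) (gker s v v)"
  by (simp add: Hs_def gker_def power2_eq_square)

lemma energy_alt:
  "energy s q v \<Omega> = gagliardo_form s v v / 2 + (LINT x:\<Omega>|lborel. \<bar>v x\<bar> powr (q + 1)) / (q + 1)"
  by (simp add: energy_def gagliardo_form_def power2_eq_square)

lemma gagliardo_form_nonneg: "0 \<le> gagliardo_form s v v"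
  unfolding gagliardo_form_gker by (intro Bochner_Integration.integral_nonneg) (simp add:
    gker_nonneg)

section \<open>Domination and closure properties of H^s\<close>

lemma square_le_sum_squares:
  fixes a b c :: real
  assumes "\<bar>c\<bar> \<le> \<bar>a\<bar> + \<bar>b\<bar>"
  shows "c\<^sup>2 \<le> 2 * a\<^sup>2 + 2 * b\<^sup>2"
proof -
  have "c\<^sup>2 \<le> (\<bar>a\<bar> + \<bar>b\<bar>)\<^sup>2"
    using assms by (metis abs_ge_zero power2_abs power_mono)
  also have "\<dots> \<le> 2 * a\<^sup>2 + 2 * b\<^sup>2"
    using sum_squares_bound[of "\<bar>a\<bar>" "\<bar>b\<bar>"] by (simp add: power2_sum)
  finally show ?thesis .
qed

text \<open>Every closure property of H^s used below comes from this domination. Two majorants are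
  allowed because sums, and later the product test functions
  \<open>\<eta> x * \<psi> n (u x)\<close>, are controlled by two functions at once; for a Lipschitz
  composition the second one is 0.\<close>

lemma Hs_dominated:
  fixes f :: "'a::euclidean_space \<Rightarrow> real"
  assumes f [measurable]: "f \<in> borel_measurable lborel"
    and v: "v \<in> Hs s" and w: "w \<in> Hs s"
    and val: "\<And>x. \<bar>f x\<bar> \<le> \<bar>v x\<bar> + \<bar>w x\<bar>"
    and dif: "\<And>x y. \<bar>f x - f y\<bar> \<le> \<bar>v x - v y\<bar> + \<bar>w x - w y\<bar>"
  shows "f \<in> Hs s"
proof -
  have [measurable]: "v \<in> borel_measurable lborel" "w \<in> borel_measurable lborel"
    using v w by (auto simp: Hs_iff)
  have "integrable lborel (\<lambda>x. (f x)\<^sup>2)"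
  proof (rule Bochner_Integration.integrable_bound)
    show "integrable lborel (\<lambda>x. 2 * (v x)\<^sup>2 + 2 * (w x)\<^sup>2)"
      using v w by (auto simp: Hs_iff)
    show "AE x in lborel. norm ((f x)\<^sup>2) \<le> norm (2 * (v x)\<^sup>2 + 2 * (w x)\<^sup>2)"
      using square_le_sum_squares[OF val] by auto
  qed auto
  moreover have "integrable (lborel \<Otimes>\<^sub>M lborel) (gker s f f)"
  proof (rule Bochner_Integration.integrable_bound)
    show "integrable (lborel \<Otimes>\<^sub>M lborel) (\<lambda>z. 2 * gker s v v z + 2 * gker s w w z)"
      using v w by (auto simp: Hs_iff)
    have "gker s f f z \<le> 2 * gker s v v z + 2 * gker s w w z" for z
    proof (cases z)
      case (Pair x y)
      have "(f x - f y)\<^sup>2 / norm (x - y) powr (real DIM('a) + 2 * s)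
        \<le> (2 * (v x - v y)\<^sup>2 + 2 * (w x - w y)\<^sup>2) / norm (x - y) powr (real DIM('a) + 2 * s)"
        by (intro divide_right_mono square_le_sum_squares dif) auto
      then show ?thesis
        by (simp add: Pair gker_def power2_eq_square add_divide_distrib)
    qed
    then show "AE z in lborel \<Otimes>\<^sub>M lborel. norm (gker s f f z)
        \<le> norm (2 * gker s v v z + 2 * gker s w w z)"
      by (simp add: gker_nonneg)
  qed auto
  ultimately show ?thesis by (simp add: Hs_iff)
qed

lemma zero_Hs [simp]: "(\<lambda>_. 0) \<in> Hs s"
proof -
  have "gker s (\<lambda>_. 0) (\<lambda>_. 0) = (\<lambda>_ :: 'a \<times> 'a. 0)"
    by (auto simp: gker_def fun_eq_iff)
  then show ?thesis by (simp add: Hs_iff)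
qed

lemma Hs_measurable: "v \<in> Hs s \<Longrightarrow> v \<in> borel_measurable lborel"
  by (simp add: Hs_iff)

lemma Hs_scale:
  assumes "v \<in> Hs s" shows "(\<lambda>x. c * v x) \<in> Hs s"
proof -
  have "integrable (lborel \<Otimes>\<^sub>M lborel) (\<lambda>z. c\<^sup>2 * gker s v v z)"
    using assms by (simp add: Hs_iff)
  also have "(\<lambda>z. c\<^sup>2 * gker s v v z) = gker s (\<lambda>x. c * v x) (\<lambda>x. c * v x)"
    by (auto simp: gker_def fun_eq_iff power2_eq_square algebra_simps)
  finally show ?thesis
    using assms by (auto simp: Hs_iff power_mult_distrib)
qed

lemma Hs_add:
  assumes v: "v \<in> Hs s" and w: "w \<in> Hs s"
  shows "(\<lambda>x. v x + w x) \<in> Hs s"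
proof (rule Hs_dominated[OF _ v w])
  show "(\<lambda>x. v x + w x) \<in> borel_measurable lborel"
    using Hs_measurable[OF v] Hs_measurable[OF w] by measurable
  show "\<bar>(v x + w x) - (v y + w y)\<bar> \<le> \<bar>v x - v y\<bar> + \<bar>w x - w y\<bar>" for x y
    using abs_triangle_ineq[of "v x - v y" "w x - w y"] by (simp add: algebra_simps)
qed (rule abs_triangle_ineq)

lemma Hs_compose:
  assumes v: "v \<in> Hs s" and T [measurable]: "T \<in> borel_measurable borel"
    and "T 0 = 0" and lip: "\<And>a b. \<bar>T a - T b\<bar> \<le> \<bar>a - b :: real\<bar>"
  shows "(\<lambda>x. T (v x)) \<in> Hs s"
proof (rule Hs_dominated[OF _ v zero_Hs])
  show "(\<lambda>x. T (v x)) \<in> borel_measurable lborel"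
    using Hs_measurable[OF v] by measurable
  show "\<bar>T (v x)\<bar> \<le> \<bar>v x\<bar> + \<bar>0\<bar>" for x
    using lip[of "v x" 0] \<open>T 0 = 0\<close> by simp
  show "\<bar>T (v x) - T (v y)\<bar> \<le> \<bar>v x - v y\<bar> + \<bar>0 - 0\<bar>" for x y
    using lip by simp
qed

lemma abs_mult_le_half_squares:
  fixes a b :: real
  shows "\<bar>a * b\<bar> \<le> a\<^sup>2 / 2 + b\<^sup>2 / 2"
  using sum_squares_bound[of "\<bar>a\<bar>" "\<bar>b\<bar>"] by (simp add: abs_mult)

text \<open>Young's inequality replaces Cauchy--Schwarz: it bounds the mixed integrand pointwise by
  the two diagonal ones.\<close>

lemma gker_integrable:
  fixes u v :: "'a::euclidean_space \<Rightarrow> real"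
  assumes u: "u \<in> Hs s" and v: "v \<in> Hs s"
  shows "integrable (lborel \<Otimes>\<^sub>M lborel) (gker s u v)"
proof (rule Bochner_Integration.integrable_bound)
  show "integrable (lborel \<Otimes>\<^sub>M lborel) (\<lambda>z. gker s u u z / 2 + gker s v v z / 2)"
    using u v by (auto simp: Hs_iff)
  show "gker s u v \<in> borel_measurable (lborel \<Otimes>\<^sub>M lborel)"
    using Hs_measurable[OF u] Hs_measurable[OF v] by measurable
  have "\<bar>gker s u v z\<bar> \<le> gker s u u z / 2 + gker s v v z / 2" for z
  proof (cases z)
    case (Pair x y)
    have "\<bar>(u x - u y) * (v x - v y)\<bar> / norm (x - y) powr (real DIM('a) + 2 * s)
        \<le> ((u x - u y)\<^sup>2 / 2 + (v x - v y)\<^sup>2 / 2) / norm (x - y) powr (real DIM('a) + 2 * s)"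
      by (intro divide_right_mono abs_mult_le_half_squares) auto
    then show ?thesis
      by (simp add: Pair gker_def power2_eq_square add_divide_distrib abs_mult)
  qed
  then show "AE z in lborel \<Otimes>\<^sub>M lborel. norm (gker s u v z)
      \<le> norm (gker s u u z / 2 + gker s v v z / 2)"
    by (simp add: gker_nonneg)
qed

lemma gagliardo_form_scale:
  "gagliardo_form s (\<lambda>x. c * u x) (\<lambda>x. d * v x) = c * d * gagliardo_form s u v"
proof -
  have "gker s (\<lambda>x. c * u x) (\<lambda>x. d * v x) = (\<lambda>z. (c * d) * gker s u v z)"
    by (auto simp: gker_def fun_eq_iff algebra_simps)
  then show ?thesis by (simp add: gagliardo_form_gker)
qed

lemma gagliardo_form_add_scale:
  assumes u: "u \<in> Hs s" and v: "v \<in> Hs s"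
  shows "gagliardo_form s (\<lambda>x. u x + t * v x) (\<lambda>x. u x + t * v x)
    = gagliardo_form s u u + 2 * t * gagliardo_form s u v + t\<^sup>2 * gagliardo_form s v v"
proof -
  have "gker s (\<lambda>x. u x + t * v x) (\<lambda>x. u x + t * v x)
      = (\<lambda>z. gker s u u z + 2 * t * gker s u v z + t\<^sup>2 * gker s v v z)"
    by (auto simp: gker_def fun_eq_iff algebra_simps power2_eq_square
        simp flip: add_divide_distrib diff_divide_distrib)
  then show ?thesis
    using gker_integrable[OF u u] gker_integrable[OF u v] gker_integrable[OF v v]
    by (simp add: gagliardo_form_gker)
qed

section \<open>The space X0\<close>

lemma X0_Hs: "v \<in> X0 s \<Omega> \<Longrightarrow> v \<in> Hs s"
  by (simp add: X0_def)

lemma X0_measurable: "v \<in> X0 s \<Omega> \<Longrightarrow> v \<in> borel_measurable lborel"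
  by (simp add: X0_def Hs_iff)

lemma X0_zero: "v \<in> X0 s \<Omega> \<Longrightarrow> AE x in lborel. x \<notin> \<Omega> \<longrightarrow> v x = 0"
  by (simp add: X0_def)

lemma X0_compose:
  assumes "v \<in> X0 s \<Omega>" "T \<in> borel_measurable borel"
    and "T 0 = 0" and "\<And>a b. \<bar>T a - T b\<bar> \<le> \<bar>a - b :: real\<bar>"
  shows "(\<lambda>x. T (v x)) \<in> X0 s \<Omega>"
  using Hs_compose[OF X0_Hs[OF assms(1)] assms(2-)] X0_zero[OF assms(1)] \<open>T 0 = 0\<close>
  by (auto simp: X0_def)

lemma X0_scale: "v \<in> X0 s \<Omega> \<Longrightarrow> (\<lambda>x. c * v x) \<in> X0 s \<Omega>"
  by (auto simp: X0_def intro: Hs_scale)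

lemma X0_add:
  assumes "v \<in> X0 s \<Omega>" "w \<in> X0 s \<Omega>" shows "(\<lambda>x. v x + w x) \<in> X0 s \<Omega>"
  using Hs_add[OF X0_Hs[OF assms(1)] X0_Hs[OF assms(2)]] X0_zero[OF assms(1)] X0_zero[OF assms(2)]
  by (auto simp: X0_def)

section \<open>Integrals over \<Omega> as integrals over the whole space\<close>

lemma set_integral_eq_integral:
  fixes f :: "'a::euclidean_space \<Rightarrow> real"
  assumes [measurable]: "f \<in> borel_measurable lborel" "\<Omega> \<in> sets borel"
    and "AE x in lborel. x \<notin> \<Omega> \<longrightarrow> f x = 0"
  shows set_integrable_iff_integrable: "set_integrable lborel \<Omega> f \<longleftrightarrow> integrable lborel f"
    and set_lebesgue_integral_eq_integral: "(LINT x:\<Omega>|lborel. f x) = (LINT x|lborel. f x)"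
proof -
  have *: "AE x in lborel. indicator \<Omega> x *\<^sub>R f x = f x"
    using assms(3) by eventually_elim (auto simp: indicator_def)
  show "set_integrable lborel \<Omega> f \<longleftrightarrow> integrable lborel f"
    unfolding set_integrable_def using * by (intro integrable_cong_AE) auto
  show "(LINT x:\<Omega>|lborel. f x) = (LINT x|lborel. f x)"
    unfolding set_lebesgue_integral_def using * by (intro integral_cong_AE) auto
qed

lemma X0_set_integral:
  fixes v :: "'a::euclidean_space \<Rightarrow> real"
  assumes v: "v \<in> X0 s \<Omega>" and \<Omega>: "\<Omega> \<in> sets borel"
    and T: "T \<in> borel_measurable borel" "T 0 = (0 :: real)"
  shows X0_set_integrable: "set_integrable lborel \<Omega> (\<lambda>x. T (v x)) \<longleftrightarrow> integrable lborel (\<lambda>x. T (v x))"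
    and X0_set_lebesgue_integral: "(LINT x:\<Omega>|lborel. T (v x)) = (LINT x|lborel. T (v x))"
proof -
  have *: "(\<lambda>x. T (v x)) \<in> borel_measurable lborel"
    using X0_measurable[OF v] T(1) by measurable
  have **: "AE x in lborel. x \<notin> \<Omega> \<longrightarrow> T (v x) = 0"
    using X0_zero[OF v] T(2) by auto
  show "set_integrable lborel \<Omega> (\<lambda>x. T (v x)) \<longleftrightarrow> integrable lborel (\<lambda>x. T (v x))"
    and "(LINT x:\<Omega>|lborel. T (v x)) = (LINT x|lborel. T (v x))"
    using set_integral_eq_integral[OF * \<Omega> **] by auto
qed

lemma abs_powr_measurable [measurable]: "(\<lambda>t::real. \<bar>t\<bar> powr r) \<in> borel_measurable borel"
  by measurable

text \<open>The convention \<open>0 powr r = 0\<close>, valid for every real \<open>r\<close>, makes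
  the power of the zero extension vanish off \<Omega>, whatever the exponent.\<close>

lemma X0_Lspace_iff:
  fixes v :: "'a::euclidean_space \<Rightarrow> real"
  assumes v: "v \<in> X0 s \<Omega>" and \<Omega> [measurable]: "\<Omega> \<in> sets borel"
  shows "v \<in> Lspace r \<Omega> \<longleftrightarrow> integrable lborel (\<lambda>x. \<bar>v x\<bar> powr r)"
proof -
  have [measurable]: "v \<in> borel_measurable lborel" using X0_measurable[OF v] .
  have "set_borel_measurable lborel \<Omega> v"
    unfolding set_borel_measurable_def by measurable
  then show ?thesis
    using X0_set_integrable[OF v \<Omega> abs_powr_measurable, of r] by (auto simp: Lspace_def)
qed

lemma X0_Lspace_integral:
  assumes "v \<in> X0 s \<Omega>" "\<Omega> \<in> sets borel"
  shows "(LINT x:\<Omega>|lborel. \<bar>v x\<bar> powr r) = (LINT x|lborel. \<bar>v x\<bar> powr r)"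
  using X0_set_lebesgue_integral[OF assms abs_powr_measurable, of r] by simp

lemma admissible_iff:
  fixes \<Omega> :: "'a::euclidean_space set"
  assumes \<Omega>: "\<Omega> \<in> sets borel"
  shows "v \<in> admissible s p q \<Omega> \<longleftrightarrow> v \<in> X0 s \<Omega> \<and> integrable lborel (\<lambda>x. \<bar>v x\<bar> powr (q + 1)) \<and>
    (LINT x|lborel. \<bar>v x\<bar> powr (p + 1)) = 1"
  using X0_Lspace_iff[OF _ \<Omega>, of v s "q + 1"] X0_Lspace_integral[OF _ \<Omega>, of v s "p + 1"]
  by (auto simp: admissible_def)

lemma energy_X0:
  fixes \<Omega> :: "'a::euclidean_space set"
  assumes "\<Omega> \<in> sets borel" "v \<in> X0 s \<Omega>"
  shows "energy s q v \<Omega> = gagliardo_form s v v / 2 + (LINT x|lborel. \<bar>v x\<bar> powr (q + 1)) / (q + 1)"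
  using X0_Lspace_integral[OF assms(2,1), of "q + 1"] by (simp add: energy_alt)

section \<open>Powers of absolute values\<close>

lemma abs_powr_sum_le:
  fixes a b r :: real
  assumes "0 \<le> r"
  shows "(\<bar>a\<bar> + \<bar>b\<bar>) powr r \<le> 2 powr r * (\<bar>a\<bar> powr r + \<bar>b\<bar> powr r)"
proof -
  have "(\<bar>a\<bar> + \<bar>b\<bar>) powr r \<le> (2 * max \<bar>a\<bar> \<bar>b\<bar>) powr r"
    using assms by (intro powr_mono2) auto
  also have "\<dots> = 2 powr r * max \<bar>a\<bar> \<bar>b\<bar> powr r"
    by (simp add: powr_mult)
  also have "\<dots> \<le> 2 powr r * (\<bar>a\<bar> powr r + \<bar>b\<bar> powr r)"
    by (intro mult_left_mono) (auto simp: max_def)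
  finally show ?thesis .
qed

lemma integrable_powr_add:
  fixes u v :: "'a \<Rightarrow> real"
  assumes [measurable]: "u \<in> borel_measurable M" "v \<in> borel_measurable M"
    and "0 \<le> r" "integrable M (\<lambda>x. \<bar>u x\<bar> powr r)" "integrable M (\<lambda>x. \<bar>v x\<bar> powr r)"
  shows "integrable M (\<lambda>x. (\<bar>u x\<bar> + \<bar>v x\<bar>) powr r)"
proof (rule Bochner_Integration.integrable_bound)
  show "integrable M (\<lambda>x. 2 powr r * (\<bar>u x\<bar> powr r + \<bar>v x\<bar> powr r))"
    using assms by simp
  show "AE x in M. norm ((\<bar>u x\<bar> + \<bar>v x\<bar>) powr r) \<le> norm (2 powr r * (\<bar>u x\<bar> powr r + \<bar>v x\<bar> powr r))"
  proof (rule AE_I2)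
    fix x
    have "0 \<le> 2 powr r * (\<bar>u x\<bar> powr r + \<bar>v x\<bar> powr r)"
      by simp
    then show "norm ((\<bar>u x\<bar> + \<bar>v x\<bar>) powr r) \<le> norm (2 powr r * (\<bar>u x\<bar> powr r + \<bar>v x\<bar> powr r))"
      using abs_powr_sum_le[OF \<open>0 \<le> r\<close>, of "u x" "v x"] by (simp only: real_norm_def abs_of_nonneg
        powr_ge_zero)
  qed
qed measurable

text \<open>The exponent \<open>r - 2\<close> is chosen so that \<open>r = p + 1\<close> and
  \<open>r = q + 1\<close> give the two terms of \<open>nonlin\<close>. Away from 0 the sign is
  constant within distance |x|, so the function is locally \<open>(sgn x * t) powr r\<close>; at 0
  the difference quotient has size |h|^{r-1}, which tends to 0 because r > 1.\<close>

lemma DERIV_abs_powr: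
  fixes x r :: real
  assumes r: "1 < r"
  shows "((\<lambda>t. \<bar>t\<bar> powr r) has_real_derivative r * (\<bar>x\<bar> powr (r - 2) * x)) (at x)"
proof (cases "x = 0")
  case True
  have "((\<lambda>h::real. \<bar>h\<bar> powr (r - 1)) \<longlongrightarrow> 0) (at 0)"
    using r by (auto intro!: tendsto_eq_intros)
  then have "((\<lambda>h::real. \<bar>\<bar>h\<bar> powr r / h\<bar>) \<longlongrightarrow> 0) (at 0)"
    by (rule Lim_transform_eventually)
      (auto simp: eventually_at_filter abs_divide powr_diff intro!: always_eventually)
  then have "((\<lambda>h::real. \<bar>h\<bar> powr r / h) \<longlongrightarrow> 0) (at 0)"
    by (rule tendsto_rabs_zero_cancel)
  then show ?thesis
    using True by (simp add: DERIV_def)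
next
  case False
  have "((\<lambda>t. \<bar>t\<bar> powr r) has_real_derivative (r * \<bar>x\<bar> powr (r - 1) * sgn x)) (at x)"
  proof -
    have "sgn x * x = \<bar>x\<bar>"
      by (simp add: abs_sgn mult.commute)
    then have "((\<lambda>t. (sgn x * t) powr r) has_real_derivative (r * \<bar>x\<bar> powr (r - 1) * sgn x)) (at x)"
      using False DERIV_chain2[of "\<lambda>z. z powr r" "r * (sgn x * x) powr (r - 1)" "\<lambda>t. sgn x * t" x
        "sgn x" UNIV]
        has_real_derivative_powr[of "sgn x * x" r]
      by (simp add: DERIV_cmult_Id)
    then show ?thesis
      by (rule has_field_derivative_transform_within[where d = "\<bar>x\<bar>"])
        (use False in \<open>auto simp: dist_real_def sgn_if abs_if split: if_splits\<close>)
  qed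
  moreover have "\<bar>x\<bar> powr (r - 1) = \<bar>x\<bar> powr (r - 2) * \<bar>x\<bar>"
    using False powr_add[of "\<bar>x\<bar>" "r - 2" 1] by simp
  ultimately show ?thesis
    by (simp add: mult.assoc abs_mult_sgn)
qed

section \<open>The Euler--Lagrange equation\<close>

text \<open>A majorant free of \<open>t\<close>, meant for dominated convergence. With m = |a| + |b|
  the derivative on [-1,1] has size at most r m^{r-1} |b|, hence at most r m^r, and the mean value
  inequality applies.\<close>

lemma abs_powr_diff_quotient_le:
  fixes a b t r :: real
  assumes r: "1 < r" and t: "t \<noteq> 0" "\<bar>t\<bar> \<le> 1"
  shows "\<bar>(\<bar>a + t * b\<bar> powr r - \<bar>a\<bar> powr r) / t\<bar> \<le> r * (\<bar>a\<bar> + \<bar>b\<bar>) powr r"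
proof -
  let ?m = "\<bar>a\<bar> + \<bar>b\<bar>"
  have "norm (\<bar>a + t * b\<bar> powr r - \<bar>a + 0 * b\<bar> powr r) \<le> r * ?m powr r * norm (t - 0)"
  proof (rule field_differentiable_bound[where S = "{-1..1}" and
      f' = "\<lambda>\<tau>. r * (\<bar>a + \<tau> * b\<bar> powr (r - 2) * (a + \<tau> * b)) * b"])
    fix \<tau> :: real assume \<tau>: "\<tau> \<in> {-1..1}"
    have "((\<lambda>\<tau>. a + \<tau> * b) has_real_derivative b) (at \<tau>)"
      by (auto intro!: derivative_eq_intros)
    from DERIV_chain2[where f = "\<lambda>t. \<bar>t\<bar> powr r", OF DERIV_abs_powr[OF r] this]
    show "((\<lambda>\<tau>. \<bar>a + \<tau> * b\<bar> powr r) has_field_derivative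
        r * (\<bar>a + \<tau> * b\<bar> powr (r - 2) * (a + \<tau> * b)) * b) (at \<tau> within {-1..1})"
      by (rule has_field_derivative_at_within)
    let ?c = "a + \<tau> * b"
    have "\<bar>\<tau> * b\<bar> \<le> \<bar>b\<bar>"
      using \<tau> by (auto simp: abs_mult intro!: mult_left_le_one_le)
    then have c: "\<bar>?c\<bar> \<le> ?m"
      using abs_triangle_ineq[of a "\<tau> * b"] by linarith
    have "norm (r * (\<bar>?c\<bar> powr (r - 2) * ?c) * b) = r * (\<bar>?c\<bar> * \<bar>?c\<bar> powr (r - 2)) * \<bar>b\<bar>"
      using r by (simp add: abs_mult)
    also have "\<dots> = r * \<bar>?c\<bar> powr (r - 1) * \<bar>b\<bar>"
      by (subst powr_mult_base) auto
    also have "\<dots> \<le> r * ?m powr (r - 1) * ?m"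
      using r c by (intro mult_mono mult_nonneg_nonneg mult_left_mono powr_mono2) auto
    also have "\<dots> = r * (?m * ?m powr (r - 1))"
      by simp
    also have "\<dots> = r * ?m powr r"
      by (subst powr_mult_base) auto
    finally show "norm (r * (\<bar>?c\<bar> powr (r - 2) * ?c) * b) \<le> r * ?m powr r" .
  qed (use t in auto)
  then show ?thesis
    using t by (simp add: abs_divide divide_le_eq)
qed

lemma DERIV_integral_abs_powr:
  fixes u v :: "'a \<Rightarrow> real"
  assumes [measurable]: "u \<in> borel_measurable M" "v \<in> borel_measurable M"
    and r: "1 < r"
    and iu: "integrable M (\<lambda>x. \<bar>u x\<bar> powr r)" and iv: "integrable M (\<lambda>x. \<bar>v x\<bar> powr r)"
  shows "((\<lambda>t. LINT x|M. \<bar>u x + t * v x\<bar> powr r) has_real_derivative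
           r * (LINT x|M. \<bar>u x\<bar> powr (r - 2) * u x * v x)) (at 0)"
    and "integrable M (\<lambda>x. \<bar>u x\<bar> powr (r - 2) * u x * v x)"
proof -
  let ?D = "\<lambda>x. r * (\<bar>u x\<bar> powr (r - 2) * u x * v x)"
  let ?q = "\<lambda>h x. (\<bar>u x + h * v x\<bar> powr r - \<bar>u x\<bar> powr r) / h"
  let ?g = "\<lambda>x. r * (\<bar>u x\<bar> + \<bar>v x\<bar>) powr r"
  have r0: "0 \<le> r" using r by simp
  have g: "integrable M ?g"
    using integrable_powr_add[OF assms(1,2) r0 iu iv] by simp
  have it: "integrable M (\<lambda>x. \<bar>u x + h * v x\<bar> powr r)" for h
  proof -
    have *: "integrable M (\<lambda>x. \<bar>h * v x\<bar> powr r)"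
      using iv by (simp add: abs_mult powr_mult)
    have hv: "(\<lambda>x. h * v x) \<in> borel_measurable M" by measurable
    show ?thesis
      by (rule Bochner_Integration.integrable_bound[OF integrable_powr_add[OF assms(1) hv r0 iu *]])
        (auto intro!: powr_mono2 simp: r0 abs_triangle_ineq)
  qed
  have lim: "(\<lambda>i. ?q (X i) x) \<longlonglongrightarrow> ?D x"
    if X: "X \<longlonglongrightarrow> 0" "\<And>i. X i \<noteq> 0" for X :: "nat \<Rightarrow> real" and x
  proof -
    have "((\<lambda>\<tau>. u x + \<tau> * v x) has_real_derivative v x) (at 0)"
      by (auto intro!: derivative_eq_intros)
    from DERIV_chain2[where f = "\<lambda>t. \<bar>t\<bar> powr r", OF DERIV_abs_powr[OF r] this]
    have "((\<lambda>h. ?q h x) \<longlongrightarrow> ?D x) (at 0)"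
      by (simp add: DERIV_def mult.assoc)
    then show ?thesis
      using X by (auto simp: tendsto_at_iff_sequentially o_def)
  qed
  have dom: "integrable M ?D \<and> (\<lambda>i. LINT x|M. ?q (X i) x) \<longlonglongrightarrow> (LINT x|M. ?D x)"
    if X: "X \<longlonglongrightarrow> 0" "\<And>i. X i \<noteq> 0" "\<And>i. \<bar>X i\<bar> \<le> 1" for X :: "nat \<Rightarrow> real"
  proof (intro conjI)
    have 1: "AE x in M. (\<lambda>i. ?q (X i) x) \<longlonglongrightarrow> ?D x"
      using lim[OF X(1,2)] by simp
    have 2: "AE x in M. norm (?q (X i) x) \<le> ?g x" for i
      using abs_powr_diff_quotient_le[OF r X(2,3)] by simp
    show "integrable M ?D"
      by (rule integrable_dominated_convergence[OF _ _ g 1 2]) measurable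
    show "(\<lambda>i. LINT x|M. ?q (X i) x) \<longlonglongrightarrow> (LINT x|M. ?D x)"
      by (rule integral_dominated_convergence[OF _ _ g 1 2]) measurable
  qed
  \<comment> \<open>Integrability of the limit follows from any one admissible null sequence;
    1/(i+1) stays in (0,1].\<close>
  have "integrable M ?D"
    using dom[of "\<lambda>i. inverse (real (Suc i))"] LIMSEQ_inverse_real_of_nat
    by (simp add: inverse_le_1_iff)
  then show "integrable M (\<lambda>x. \<bar>u x\<bar> powr (r - 2) * u x * v x)"
    using r by simp
  have "(\<lambda>i. LINT x|M. ?q (X i) x) \<longlonglongrightarrow> (LINT x|M. ?D x)"
    if X: "X \<longlonglongrightarrow> 0" "\<And>i. X i \<noteq> 0" for X :: "nat \<Rightarrow> real"
  proof -
    \<comment> \<open>The majorant holds for steps of size at most 1 only, so an initial segment is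
      discarded.\<close>
    obtain N where N: "\<And>n. n \<ge> N \<Longrightarrow> \<bar>X n\<bar> < 1"
      using LIMSEQ_D[OF X(1), of 1] by auto
    have "(\<lambda>i. LINT x|M. ?q (X (i + N)) x) \<longlonglongrightarrow> (LINT x|M. ?D x)"
      using dom[of "\<lambda>i. X (i + N)"] LIMSEQ_ignore_initial_segment[OF X(1), of N] X(2) N
      by (simp add: less_imp_le)
    then show ?thesis
      by (rule LIMSEQ_offset)
  qed
  then have "((\<lambda>h. LINT x|M. ?q h x) \<longlongrightarrow> (LINT x|M. ?D x)) (at 0)"
    by (auto simp: tendsto_at_iff_sequentially o_def)
  then show "((\<lambda>t. LINT x|M. \<bar>u x + t * v x\<bar> powr r) has_real_derivative
           r * (LINT x|M. \<bar>u x\<bar> powr (r - 2) * u x * v x)) (at 0)"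
    unfolding DERIV_def using it it[of 0] by simp
qed

text \<open>Where |v| is at most 1 the power is bounded by the indicator of \<Omega>, elsewhere by
  the larger power.\<close>

lemma integrable_powr_smaller_exponent:
  fixes v :: "'a::euclidean_space \<Rightarrow> real"
  assumes [measurable]: "v \<in> borel_measurable lborel" and zero: "AE x in lborel. x \<notin> \<Omega> \<longrightarrow> v x = 0"
    and [measurable]: "\<Omega> \<in> sets borel" and fin: "emeasure lborel \<Omega> < \<infinity>"
    and iv: "integrable lborel (\<lambda>x. \<bar>v x\<bar> powr b)" and "0 < a" "a \<le> b"
  shows "integrable lborel (\<lambda>x. \<bar>v x\<bar> powr a)"
proof (rule Bochner_Integration.integrable_bound)
  show "integrable lborel (\<lambda>x. indicator \<Omega> x + \<bar>v x\<bar> powr b)"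
    using fin iv by (intro Bochner_Integration.integrable_add integrable_real_indicator) auto
  show "(\<lambda>x. \<bar>v x\<bar> powr a) \<in> borel_measurable lborel" by measurable
  show "AE x in lborel. norm (\<bar>v x\<bar> powr a) \<le> norm (indicator \<Omega> x + \<bar>v x\<bar> powr b :: real)"
    using zero
  proof eventually_elim
    case (elim x)
    show ?case
    proof (cases "\<bar>v x\<bar> \<le> 1")
      case True
      then have "\<bar>v x\<bar> powr a \<le> 1"
        using \<open>0 < a\<close> powr_le1[of a "\<bar>v x\<bar>"] by auto
      then show ?thesis
        using elim by (cases "x \<in> \<Omega>") (auto simp: add_increasing2)
    next
      case False
      then have "\<bar>v x\<bar> powr a \<le> \<bar>v x\<bar> powr b"
        using \<open>a \<le> b\<close> by (intro powr_mono) auto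
      then show ?thesis
        by (auto simp: indicator_def)
    qed
  qed
qed

lemmas X0_integrable_powr = integrable_powr_smaller_exponent[OF X0_measurable X0_zero]

text \<open>The factor \<open>N powr (- 1 / (p + 1))\<close> restores the constraint. The two parts
  of the energy are homogeneous of degrees 2 and q + 1, so they pick up different powers of
  \<open>N\<close>.\<close>

lemma admissible_normalize:
  fixes v :: "'a::euclidean_space \<Rightarrow> real"
  assumes \<Omega>: "\<Omega> \<in> sets borel" and v: "v \<in> X0 s \<Omega>"
    and iv: "integrable lborel (\<lambda>x. \<bar>v x\<bar> powr (q + 1))"
    and N: "N = (LINT x|lborel. \<bar>v x\<bar> powr (p + 1))" "0 < N" and "0 < p"
  defines "w \<equiv> \<lambda>x. N powr (- 1 / (p + 1)) * v x"
  shows "w \<in> admissible s p q \<Omega>"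
    and "energy s q w \<Omega> = gagliardo_form s v v / 2 * N powr (- 2 / (p + 1)) +
      (LINT x|lborel. \<bar>v x\<bar> powr (q + 1)) / (q + 1) * N powr (- (q + 1) / (p + 1))"
proof -
  have w: "w \<in> X0 s \<Omega>"
    unfolding w_def by (rule X0_scale[OF v])
  have pw: "\<bar>w x\<bar> powr r = N powr (- r / (p + 1)) * \<bar>v x\<bar> powr r" for x r
    by (simp add: w_def abs_mult powr_mult powr_powr)
  have "(LINT x|lborel. \<bar>w x\<bar> powr (p + 1)) = N powr (- (p + 1) / (p + 1)) * N"
    by (simp only: pw N(1) integral_mult_right_zero)
  also have "- (p + 1) / (p + 1) = - 1"
    using \<open>0 < p\<close> by (simp add: field_simps)
  finally have "(LINT x|lborel. \<bar>w x\<bar> powr (p + 1)) = 1"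
    using N(2) by (simp add: powr_minus)
  then show "w \<in> admissible s p q \<Omega>"
    unfolding admissible_iff[OF \<Omega>] using w iv by (simp add: pw)
  have "N powr (- 1 / (p + 1)) * N powr (- 1 / (p + 1)) = N powr (- 2 / (p + 1))"
    by (simp flip: powr_add)
  moreover have "gagliardo_form s w w = N powr (- 1 / (p + 1)) * N powr (- 1 / (p + 1)) *
    gagliardo_form s v v"
    unfolding w_def by (rule gagliardo_form_scale)
  ultimately show "energy s q w \<Omega> = gagliardo_form s v v / 2 * N powr (- 2 / (p + 1)) +
      (LINT x|lborel. \<bar>v x\<bar> powr (q + 1)) / (q + 1) * N powr (- (q + 1) / (p + 1))"
    unfolding energy_X0[OF \<Omega> w] by (simp add: pw mult.commute)
qed

text \<open>Here \<open>f t\<close> is the energy of the normalized perturbation, so it has a local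
  minimum at 0. Since \<open>N 0 = 1\<close> and the derivative of \<open>N\<close> there is
  \<open>(p + 1) * N'\<close>, a factor \<open>N t powr (- c / (p + 1))\<close> has derivative
  \<open>- c * N'\<close>. For c = 2 and c = q + 1 these numbers cancel the denominators 2 and q + 1
  of the energy, and the coefficients of \<open>N'\<close> add up to \<open>- lam\<close>.\<close>

lemma euler_lagrange:
  fixes u \<phi> :: "'a::euclidean_space \<Rightarrow> real"
  assumes \<Omega>: "\<Omega> \<in> sets borel" and fin: "emeasure lborel \<Omega> < \<infinity>"
    and p: "0 < p" "p < q"
    and u: "u \<in> admissible s p q \<Omega>"
    and min: "\<And>v. v \<in> admissible s p q \<Omega> \<Longrightarrow> energy s q u \<Omega> \<le> energy s q v \<Omega>"
    and \<phi>: "\<phi> \<in> X0 s \<Omega>" and i\<phi>: "integrable lborel (\<lambda>x. \<bar>\<phi> x\<bar> powr (q + 1))"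
    and lam: "lam = gagliardo_form s u u + (LINT x|lborel. \<bar>u x\<bar> powr (q + 1))"
  shows "gagliardo_form s u \<phi> = (LINT x|lborel. nonlin p q lam (u x) * \<phi> x)"
    and "integrable lborel (\<lambda>x. nonlin p q lam (u x) * \<phi> x)"
proof -
  have uX: "u \<in> X0 s \<Omega>" and iu: "integrable lborel (\<lambda>x. \<bar>u x\<bar> powr (q + 1))"
    and u1: "(LINT x|lborel. \<bar>u x\<bar> powr (p + 1)) = 1"
    using u unfolding admissible_iff[OF \<Omega>] by auto
  note [measurable] = X0_measurable[OF uX] X0_measurable[OF \<phi>]
  define G where "G t = gagliardo_form s u u + 2 * t * gagliardo_form s u \<phi> + t\<^sup>2 * gagliardo_form
    s \<phi> \<phi>" for t
  define N where "N t = (LINT x|lborel. \<bar>u x + t * \<phi> x\<bar> powr (p + 1))" for t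
  define B where "B t = (LINT x|lborel. \<bar>u x + t * \<phi> x\<bar> powr (q + 1))" for t
  define f where "f t = G t / 2 * N t powr (- 2 / (p + 1)) + B t / (q + 1) * N t powr (- (q + 1) /
    (p + 1))" for t
  define N' where "N' = (LINT x|lborel. \<bar>u x\<bar> powr (p - 1) * u x * \<phi> x)"
  define B' where "B' = (LINT x|lborel. \<bar>u x\<bar> powr (q - 1) * u x * \<phi> x)"
  have ip: "integrable lborel (\<lambda>x. \<bar>u x\<bar> powr (p + 1))" "integrable lborel (\<lambda>x. \<bar>\<phi> x\<bar> powr (p + 1))"
    using p by (auto intro!: X0_integrable_powr[OF uX uX \<Omega> fin iu] X0_integrable_powr[OF \<phi> \<phi> \<Omega> fin
      i\<phi>])
  have dN: "(N has_real_derivative (p + 1) * N') (at 0)"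
    and iN: "integrable lborel (\<lambda>x. \<bar>u x\<bar> powr (p - 1) * u x * \<phi> x)"
    using DERIV_integral_abs_powr[of u lborel \<phi> "p + 1"] p ip by (auto simp: N'_def N_def[abs_def])
  have dB: "(B has_real_derivative (q + 1) * B') (at 0)"
    and iB: "integrable lborel (\<lambda>x. \<bar>u x\<bar> powr (q - 1) * u x * \<phi> x)"
    using DERIV_integral_abs_powr[of u lborel \<phi> "q + 1"] p iu i\<phi> by (auto simp: B'_def
      B_def[abs_def])
  have dG: "(G has_real_derivative 2 * gagliardo_form s u \<phi>) (at 0)"
    unfolding G_def by (auto intro!: derivative_eq_intros)
  have N0: "N 0 = 1" and B0: "B 0 = (LINT x|lborel. \<bar>u x\<bar> powr (q + 1))" and G0: "G 0 =
    gagliardo_form s u u"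
    by (simp_all add: N_def B_def G_def u1)
  have dP: "((\<lambda>t. N t powr (- c / (p + 1))) has_real_derivative - c * N') (at 0)" for c
    by (rule DERIV_cong[OF DERIV_chain2[where f = "\<lambda>z. z powr (- c / (p + 1))", OF
      has_real_derivative_powr dN]])
      (use N0 p in auto)
  have dB': "((\<lambda>t. B t / (q + 1)) has_real_derivative B') (at 0)"
    using DERIV_cdivide[OF dB, of "q + 1"] p by simp
  have dG': "((\<lambda>t. G t / 2) has_real_derivative gagliardo_form s u \<phi>) (at 0)"
    using DERIV_cdivide[OF dG, of 2] by simp
  have q: "(- q - 1) * N' * b / (q + 1) = - (b * N')" for b
    using p by (simp add: field_simps)
  have df: "(f has_real_derivative gagliardo_form s u \<phi> + B' - lam * N') (at 0)"
    unfolding f_def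
    by (rule DERIV_cong[OF DERIV_add[OF DERIV_mult[OF dG' dP] DERIV_mult[OF dB' dP]]])
      (simp add: N0 B0 G0 lam distrib_right q)
  \<comment> \<open>Normalizing requires positive L^{p+1} mass; continuity and
    \<open>N 0 = 1\<close> give it on an interval around 0.\<close>
  have "isCont N 0"
    using dN by (rule DERIV_isCont)
  then have "(N \<longlongrightarrow> 1) (at 0)"
    by (simp add: isCont_def N0)
  then have "eventually (\<lambda>t. 0 < N t) (at 0)"
    by (rule order_tendstoD) simp
  then obtain d where d: "0 < d" "\<And>t. t \<noteq> 0 \<Longrightarrow> \<bar>t\<bar> < d \<Longrightarrow> 0 < N t"
    by (auto simp: eventually_at dist_real_def)
  have "f 0 \<le> f t" if "\<bar>0 - t\<bar> < d" for t
  proof -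
    have N: "0 < N t" using d(2)[of t] that by (cases "t = 0") (auto simp: N0)
    have v: "(\<lambda>x. u x + t * \<phi> x) \<in> X0 s \<Omega>"
      by (intro X0_add X0_scale uX \<phi>)
    have *: "(\<lambda>x. t * \<phi> x) \<in> borel_measurable lborel" "0 \<le> q + 1"
      "integrable lborel (\<lambda>x. \<bar>t * \<phi> x\<bar> powr (q + 1))"
      using i\<phi> p by (auto simp: abs_mult powr_mult)
    have iv: "integrable lborel (\<lambda>x. \<bar>u x + t * \<phi> x\<bar> powr (q + 1))"
      by (rule Bochner_Integration.integrable_bound[OF integrable_powr_add[OF _ *(1,2) iu *(3)]])
        (use p in \<open>auto intro!: powr_mono2 abs_triangle_ineq\<close>)
    have "energy s q u \<Omega> \<le> f t"
      using min[OF admissible_normalize(1)[OF \<Omega> v iv N_def[of t] N p(1)]]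
      unfolding admissible_normalize(2)[OF \<Omega> v iv N_def[of t] N p(1)]
      using gagliardo_form_add_scale[OF X0_Hs[OF uX] X0_Hs[OF \<phi>], of t]
      by (simp add: f_def G_def B_def)
    then show ?thesis
      by (simp add: energy_X0[OF \<Omega> uX] f_def N0 G0 B0)
  qed
  then have "gagliardo_form s u \<phi> + B' - lam * N' = 0"
    using DERIV_local_min[OF df d(1)] by blast
  then show "gagliardo_form s u \<phi> = (LINT x|lborel. nonlin p q lam (u x) * \<phi> x)"
    using iN iB by (simp add: nonlin_def left_diff_distrib N'_def B'_def mult.assoc)
  show "integrable lborel (\<lambda>x. nonlin p q lam (u x) * \<phi> x)"
    using iN iB by (simp add: nonlin_def left_diff_distrib mult.assoc)
qed

section \<open>Admissible functions exist\<close>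

text \<open>The convolution kernel that dominates the Gagliardo integrand of a bounded Lipschitz
  function: the numerator is quadratic near the diagonal and constant away from it.\<close>

definition rker :: "real \<Rightarrow> 'a::euclidean_space \<Rightarrow> real" where
  "rker s z = min 1 ((norm z)\<^sup>2) / norm z powr (real DIM('a) + 2 * s)"

lemma rker_measurable [measurable]: "rker s \<in> borel_measurable borel"
  unfolding rker_def by measurable

lemma rker_nonneg: "0 \<le> rker s z"
  by (auto simp: rker_def)

text \<open>The index k is that of the dyadic shell 2^{-k-1} < |z| \<le> 2^{-k}. Numerator and
  denominator are estimated separately, |z|^2 by 2^{-2k} and the negative power of |z| by the inner
  radius, so the sign of N + 2s - 2 does not enter.\<close>

lemma rker_le_inner:
  fixes z :: "'a::euclidean_space"
  assumes s: "0 < s" and z: "z \<noteq> 0" "norm z \<le> 1"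
  shows "\<exists>k::nat. norm z \<le> 2 powr (- real k) \<and>
    rker s z \<le> 2 powr (real DIM('a) + 2 * s + real k * (real DIM('a) + 2 * s - 2))"
proof -
  let ?a = "real DIM('a) + 2 * s"
  define L where "L = log 2 (norm z)"
  have n: "norm z = 2 powr L" using z by (simp add: L_def)
  have L: "L \<le> 0" using z by (simp add: L_def)
  define k where "k = nat \<lfloor>- L\<rfloor>"
  have k: "real k \<le> - L" "- L < real k + 1"
    using L unfolding k_def by linarith+
  have "rker s z \<le> (norm z)\<^sup>2 / norm z powr ?a"
    unfolding rker_def by (intro divide_right_mono) auto
  also have "\<dots> = 2 powr (2 * L - ?a * L)"
    unfolding n by (simp add: powr_diff powr_powr power2_eq_square flip: powr_add)
       (simp add: mult.commute)
  also have "\<dots> \<le> 2 powr (?a + real k * (?a - 2))"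
  proof (rule powr_mono)
    have "?a * (- L) \<le> ?a * (real k + 1)" using k s by (intro mult_left_mono) auto
    then show "2 * L - ?a * L \<le> ?a + real k * (?a - 2)"
      using k by (simp add: algebra_simps)
  qed simp
  finally show ?thesis
    using k n by (intro exI[of _ k]) (auto intro!: powr_mono)
qed

lemma rker_le_outer:
  fixes z :: "'a::euclidean_space"
  assumes s: "0 < s" and z: "1 \<le> norm z"
  shows "\<exists>k::nat. norm z \<le> 2 powr (real k + 1) \<and> rker s z \<le> 2 powr (- (real k * (real DIM('a) + 2
    * s)))"
proof -
  let ?a = "real DIM('a) + 2 * s"
  define L where "L = log 2 (norm z)"
  have "z \<noteq> 0" using z by auto
  then have n: "norm z = 2 powr L" by (simp add: L_def)
  have L: "0 \<le> L" using z \<open>z \<noteq> 0\<close> by (simp add: L_def)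
  define k where "k = nat \<lfloor>L\<rfloor>"
  have k: "real k \<le> L" "L < real k + 1"
    using L unfolding k_def by linarith+
  have "rker s z \<le> 1 / norm z powr ?a"
    unfolding rker_def by (intro divide_right_mono) auto
  also have "\<dots> = 2 powr (- (L * ?a))"
    unfolding n by (simp add: powr_powr powr_minus divide_inverse)
  also have "\<dots> \<le> 2 powr (- (real k * ?a))"
    using k s by (intro powr_mono) (auto intro!: mult_right_mono)
  finally show ?thesis
    using k n by (intro exI[of _ k]) (auto intro!: powr_mono)
qed

lemma suminf_geometric_ennreal_finite:
  assumes "0 \<le> C" "\<theta> < 0"
  shows "(\<Sum>k::nat. ennreal (C * 2 powr (real k * \<theta>))) < \<infinity>"
proof -
  have "(2::real) powr \<theta> < 1"
    using assms by (simp add: powr_less_one)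
  then have "summable (\<lambda>k. C * (2 powr \<theta>) ^ k)"
    by (intro summable_mult summable_geometric) simp
  also have "(\<lambda>k. C * (2 powr \<theta>) ^ k) = (\<lambda>k. C * 2 powr (real k * \<theta>))"
    by (simp add: powr_powr mult.commute flip: powr_realpow)
  finally show ?thesis
    using assms ennreal_suminf_neq_top by (fastforce simp: less_top)
qed

text \<open>Dyadic balls replace polar coordinates. The volume of the k-th ball contributes 2^{-kN}
  inside and 2^{kN} outside, which leaves geometric series with ratios 2^{2s-2} and 2^{-2s}; they
  converge because s < 1 and s > 0 respectively. Using balls instead of shells only enlarges the
  majorant.\<close>

lemma nn_integral_rker_finite:
  assumes s: "0 < s" "s < 1"
  shows "(\<integral>\<^sup>+z. ennreal (rker s (z::'a::euclidean_space)) \<partial>lborel) < \<infinity>"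
proof -
  let ?N = "real DIM('a)"
  let ?V = "unit_ball_vol ?N"
  define c where "c k = 2 powr (?N + 2 * s + real k * (?N + 2 * s - 2))" for k :: nat
  define d where "d k = 2 powr (- (real k * (?N + 2 * s)))" for k :: nat
  define A :: "nat \<Rightarrow> 'a set" where "A k = cball 0 (2 powr (- real k))" for k
  define B :: "nat \<Rightarrow> 'a set" where "B k = cball 0 (2 powr (real k + 1))" for k
  have [measurable]: "A k \<in> sets borel" "B k \<in> sets borel" for k
    by (auto simp: A_def B_def)
  have bound: "ennreal (rker s z) \<le> (\<Sum>k. ennreal (c k) * indicator (A k) z) + (\<Sum>k. ennreal (d k) *
    indicator (B k) z)" for z :: 'a
  proof -
    have up: "f k \<le> suminf f" for f :: "nat \<Rightarrow> ennreal" and k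
      using sum_le_suminf[of f "{k}"] by auto
    consider "z = 0" | "z \<noteq> 0" "norm z \<le> 1" | "1 \<le> norm z" by linarith
    then show ?thesis
    proof cases
      case 1 then show ?thesis by (simp add: rker_def)
    next
      case 2
      then obtain k where "norm z \<le> 2 powr (- real k)" "rker s z \<le> c k"
        using rker_le_inner[OF s(1)] unfolding c_def by blast
      then have "ennreal (rker s z) \<le> ennreal (c k) * indicator (A k) z"
        by (simp add: A_def ennreal_leI)
      also note up
      also have "(\<Sum>k. ennreal (c k) * indicator (A k) z) \<le> (\<Sum>k. ennreal (c k) * indicator (A k) z)
        + (\<Sum>k. ennreal (d k) * indicator (B k) z)"
        by simp
      finally show ?thesis .
    next
      case 3
      then obtain k where "norm z \<le> 2 powr (real k + 1)" "rker s z \<le> d k"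
        using rker_le_outer[OF s(1)] unfolding d_def by blast
      then have "ennreal (rker s z) \<le> ennreal (d k) * indicator (B k) z"
        by (simp add: B_def ennreal_leI)
      also note up
      also have "(\<Sum>k. ennreal (d k) * indicator (B k) z) \<le> (\<Sum>k. ennreal (c k) * indicator (A k) z)
        + (\<Sum>k. ennreal (d k) * indicator (B k) z)"
        by simp
      finally show ?thesis .
    qed
  qed
  have "(\<integral>\<^sup>+z. ennreal (rker s (z::'a)) \<partial>lborel)
      \<le> (\<integral>\<^sup>+z. (\<Sum>k. ennreal (c k) * indicator (A k) z) + (\<Sum>k. ennreal (d k) * indicator (B k) z)
        \<partial>lborel)"
    by (intro nn_integral_mono bound)
  also have "\<dots> = (\<Sum>k. ennreal (c k) * emeasure lborel (A k)) + (\<Sum>k. ennreal (d k) * emeasure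
    lborel (B k))"
    by (simp add: nn_integral_add nn_integral_suminf nn_integral_cmult_indicator)
  also have "(\<Sum>k. ennreal (c k) * emeasure lborel (A k))
      = (\<Sum>k. ennreal ((2 powr (?N + 2 * s) * ?V) * 2 powr (real k * (2 * s - 2))))"
  proof (rule suminf_cong)
    fix k
    have "c k * (?V * (2 powr (- real k)) ^ DIM('a)) = 2 powr (?N + 2 * s) * ?V * 2 powr (real k *
      (2 * s - 2))"
      by (simp add: c_def powr_powr algebra_simps flip: powr_realpow powr_add)
    then show "ennreal (c k) * emeasure lborel (A k) = ennreal ((2 powr (?N + 2 * s) * ?V) * 2
      powr (real k * (2 * s - 2)))"
      by (simp add: A_def emeasure_cball c_def flip: ennreal_mult)
  qed
  also have "(\<Sum>k. ennreal (d k) * emeasure lborel (B k))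
      = (\<Sum>k. ennreal ((2 powr ?N * ?V) * 2 powr (real k * (- 2 * s))))"
  proof (rule suminf_cong)
    fix k
    have "d k * (?V * (2 powr (real k + 1)) ^ DIM('a)) = 2 powr ?N * ?V * 2 powr (real k * (- 2 *
      s))"
      by (simp add: d_def powr_powr algebra_simps flip: powr_realpow powr_add)
    then show "ennreal (d k) * emeasure lborel (B k) = ennreal ((2 powr ?N * ?V) * 2 powr (real k
      * (- 2 * s)))"
      by (simp add: B_def emeasure_cball d_def flip: ennreal_mult)
  qed
  also have "(\<Sum>k. ennreal ((2 powr (?N + 2 * s) * ?V) * 2 powr (real k * (2 * s - 2)))) +
      (\<Sum>k. ennreal ((2 powr ?N * ?V) * 2 powr (real k * (- 2 * s)))) < \<infinity>"
    unfolding infinity_ennreal_def ennreal_add_less_top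
  proof (intro conjI suminf_geometric_ennreal_finite[unfolded infinity_ennreal_def])
    show "0 \<le> 2 powr (?N + 2 * s) * ?V" "0 \<le> 2 powr ?N * ?V"
      by (auto intro!: mult_nonneg_nonneg)
  qed (use s in auto)
  finally show ?thesis .
qed

lemma nn_integral_rker_translate:
  fixes x :: "'a::euclidean_space"
  shows "(\<integral>\<^sup>+y. ennreal (rker s (x - y)) \<partial>lborel) = (\<integral>\<^sup>+z. ennreal (rker s (z::'a)) \<partial>lborel)"
proof -
  have "(\<integral>\<^sup>+z. ennreal (rker s (z::'a)) \<partial>lborel) = (\<integral>\<^sup>+z. ennreal (rker s (z::'a)) \<partial>distr lborel
    borel ((+) (- x)))"
    by (simp add: lborel_distr_plus)
  also have "\<dots> = (\<integral>\<^sup>+y. ennreal (rker s (- x + y)) \<partial>lborel)"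
    by (subst nn_integral_distr) auto
  also have "(\<lambda>y. rker s (- x + y)) = (\<lambda>y. rker s (x - y))"
    by (simp add: rker_def norm_minus_commute)
  finally show ?thesis by simp
qed

text \<open>The weight selects the pairs with at least one point in \<Omega>, the only ones at which
  a function vanishing off \<Omega> can have a nonzero difference. Tonelli's theorem in either order
  gives the kernel integral times the measure of \<Omega>.\<close>

lemma nn_integral_rker_pair_finite:
  fixes \<Omega> :: "'a::euclidean_space set"
  assumes s: "0 < s" "s < 1" and [measurable]: "\<Omega> \<in> sets borel" and fin: "emeasure lborel \<Omega> < \<infinity>"
  shows "(\<integral>\<^sup>+z. ennreal (rker s (fst z - snd z)) * (indicator \<Omega> (fst z) + indicator \<Omega> (snd z))
    \<partial>(lborel \<Otimes>\<^sub>M lborel)) < \<infinity>"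
proof -
  let ?I = "\<integral>\<^sup>+z. ennreal (rker s (z::'a)) \<partial>lborel"
  have 1: "(\<integral>\<^sup>+z. ennreal (rker s (fst z - snd z)) * indicator \<Omega> (fst z) \<partial>(lborel \<Otimes>\<^sub>M lborel)) =
    ?I * emeasure lborel \<Omega>"
    by (subst lborel.nn_integral_fst[symmetric])
      (simp_all add: nn_integral_multc nn_integral_rker_translate nn_integral_cmult)
  have 2: "(\<integral>\<^sup>+z. ennreal (rker s (fst z - snd z)) * indicator \<Omega> (snd z) \<partial>(lborel \<Otimes>\<^sub>M lborel)) =
    ?I * emeasure lborel \<Omega>"
  proof (subst lborel_pair.nn_integral_snd[symmetric])
    have *: "rker s (x - y) = rker s (y - x)" for x y :: 'a
      by (simp add: rker_def norm_minus_commute)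
    show "(\<integral>\<^sup>+ y. \<integral>\<^sup>+ x. ennreal (rker s (fst (x, y) - snd (x, y))) * indicator \<Omega> (snd (x, y))
      \<partial>lborel \<partial>lborel)
        = ?I * emeasure lborel \<Omega>"
      by (subst *[of "fst _" "snd _"]) (simp add: nn_integral_multc nn_integral_rker_translate
        nn_integral_cmult)
  qed simp
  have "?I * emeasure lborel \<Omega> < \<infinity>"
    using nn_integral_rker_finite[OF s, where 'a='a] fin by (simp add: ennreal_mult_less_top)
  then show ?thesis
    by (simp add: distrib_left nn_integral_add 1 2)
qed

lemma lipschitz_in_X0:
  fixes \<eta> :: "'a::euclidean_space \<Rightarrow> real"
  assumes s: "0 < s" "s < 1" and [measurable]: "\<Omega> \<in> sets borel" and fin: "emeasure lborel \<Omega> < \<infinity>"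
    and [measurable]: "\<eta> \<in> borel_measurable borel"
    and lip: "\<And>x y. \<bar>\<eta> x - \<eta> y\<bar> \<le> norm (x - y)"
    and nonneg: "\<And>x. 0 \<le> \<eta> x" and bound: "\<And>x. \<eta> x \<le> B" and zero: "\<And>x. x \<notin> \<Omega> \<Longrightarrow> \<eta> x = 0"
  shows "\<eta> \<in> X0 s \<Omega>"
proof -
  \<comment> \<open>The 1 comes from the Lipschitz constant, for close points;
    \<open>B\<^sup>2\<close> comes from the range [0,B], for distant ones.\<close>
  define C where "C = max 1 (B\<^sup>2)"
  have "integrable lborel (\<lambda>x. (\<eta> x)\<^sup>2)"
  proof (rule Bochner_Integration.integrable_bound)
    show "integrable lborel (\<lambda>x. B\<^sup>2 * indicator \<Omega> x)"
      using fin by (intro integrable_mult_right integrable_real_indicator) auto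
    show "AE x in lborel. norm ((\<eta> x)\<^sup>2) \<le> norm (B\<^sup>2 * indicator \<Omega> x)"
      using nonneg bound zero by (auto simp: indicator_def intro!: power_mono)
  qed auto
  moreover have "integrable (lborel \<Otimes>\<^sub>M lborel) (gker s \<eta> \<eta>)"
  proof (rule integrableI_bounded)
    have *: "gker s \<eta> \<eta> z \<le> C * (rker s (fst z - snd z) * (indicator \<Omega> (fst z) + indicator \<Omega> (snd
      z)))" for z
    proof (cases z)
      case (Pair x y)
      let ?n = "norm (x - y) powr (real DIM('a) + 2 * s)"
      let ?i = "indicator \<Omega> x + indicator \<Omega> y :: real"
      have "(\<eta> x - \<eta> y)\<^sup>2 \<le> C * min 1 ((norm (x - y))\<^sup>2) * ?i"
      proof (cases "x \<in> \<Omega> \<or> y \<in> \<Omega>")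
        case True
        have a: "(\<eta> x - \<eta> y)\<^sup>2 \<le> (norm (x - y))\<^sup>2"
          using lip[of x y] by (metis abs_ge_zero power2_abs power_mono)
        have "\<bar>\<eta> x - \<eta> y\<bar> \<le> B"
          using nonneg[of x] nonneg[of y] bound[of x] bound[of y] by linarith
        then have b: "(\<eta> x - \<eta> y)\<^sup>2 \<le> B\<^sup>2"
          by (metis abs_ge_zero power2_abs power_mono)
        have "(\<eta> x - \<eta> y)\<^sup>2 \<le> C * min 1 ((norm (x - y))\<^sup>2)"
        proof (cases "1 \<le> (norm (x - y))\<^sup>2")
          case True then show ?thesis using b by (simp add: C_def)
        next
          case False
          have "1 * (norm (x - y))\<^sup>2 \<le> C * (norm (x - y))\<^sup>2"
            by (intro mult_right_mono) (auto simp: C_def)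
          then show ?thesis using a False by simp
        qed
        also have "\<dots> = C * min 1 ((norm (x - y))\<^sup>2) * 1"
          by simp
        also have "\<dots> \<le> C * min 1 ((norm (x - y))\<^sup>2) * ?i"
          using True by (intro mult_left_mono) (auto simp: C_def indicator_def)
        finally show ?thesis .
      qed (auto simp: zero)
      then have "(\<eta> x - \<eta> y)\<^sup>2 / ?n \<le> C * min 1 ((norm (x - y))\<^sup>2) * ?i / ?n"
        by (rule divide_right_mono) simp
      then show ?thesis
        by (simp add: Pair gker_def rker_def power2_eq_square)
    qed
    have "(\<integral>\<^sup>+z. ennreal (norm (gker s \<eta> \<eta> z)) \<partial>(lborel \<Otimes>\<^sub>M lborel))
      \<le> (\<integral>\<^sup>+z. ennreal C * (ennreal (rker s (fst z - snd z)) * (indicator \<Omega> (fst z) + indicator \<Omega>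
        (snd z))) \<partial>(lborel \<Otimes>\<^sub>M lborel))"
    proof (intro nn_integral_mono)
      fix z :: "'a \<times> 'a"
      have "ennreal C * (ennreal (rker s (fst z - snd z)) * (indicator \<Omega> (fst z) + indicator \<Omega>
        (snd z)))
        = ennreal (C * (rker s (fst z - snd z) * (indicator \<Omega> (fst z) + indicator \<Omega> (snd z))))"
        by (simp add: C_def rker_nonneg ennreal_mult flip: ennreal_indicator ennreal_plus)
      then show "ennreal (norm (gker s \<eta> \<eta> z)) \<le>
          ennreal C * (ennreal (rker s (fst z - snd z)) * (indicator \<Omega> (fst z) + indicator \<Omega> (snd
            z)))"
        using *[of z] by (simp only: real_norm_def abs_of_nonneg gker_nonneg ennreal_leI)
    qed
    also have "\<dots> < \<infinity>"
      using nn_integral_rker_pair_finite[OF s assms(3) fin]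
      by (subst nn_integral_cmult) (auto simp: ennreal_mult_less_top)
    finally show "(\<integral>\<^sup>+z. ennreal (norm (gker s \<eta> \<eta> z)) \<partial>(lborel \<Otimes>\<^sub>M lborel)) < \<infinity>" .
  qed simp
  ultimately show ?thesis
    by (simp add: X0_def Hs_iff zero)
qed

lemma infdist_in_X0:
  fixes \<Omega> :: "'a::euclidean_space set"
  assumes s: "0 < s" "s < 1" and \<Omega>: "open \<Omega>" "bounded \<Omega>"
  defines "\<eta> \<equiv> \<lambda>x. infdist x (- \<Omega>)"
  shows "\<eta> \<in> X0 s \<Omega>" and "\<exists>B. \<forall>x. \<eta> x \<le> B" and "\<And>x. 0 \<le> \<eta> x" and "\<And>x. 0 < \<eta> x \<longleftrightarrow> x \<in> \<Omega>"
proof -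
  \<comment> \<open>The distance to the empty set is 0 by convention, so a point outside \<Omega> is
    secured before positivity in \<Omega> can be claimed.\<close>
  have "\<Omega> \<noteq> UNIV" using \<Omega>(2) not_bounded_UNIV by auto
  then obtain z where z: "z \<notin> \<Omega>" by auto
  obtain R where R: "\<And>x. x \<in> \<Omega> \<Longrightarrow> norm x \<le> R"
    using \<Omega>(2) by (auto simp: bounded_iff)
  show nonneg: "0 \<le> \<eta> x" for x
    by (simp add: \<eta>_def infdist_nonneg)
  have z0: "\<eta> x = 0" if "x \<notin> \<Omega>" for x
    using that by (simp add: \<eta>_def)
  have "closed (- \<Omega>)" "- \<Omega> \<noteq> {}" using \<Omega>(1) z by auto
  then have "x \<in> - \<Omega> \<longleftrightarrow> \<eta> x = 0" for x
    unfolding \<eta>_def by (rule in_closed_iff_infdist_zero)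
  then show "0 < \<eta> x \<longleftrightarrow> x \<in> \<Omega>" for x
    using nonneg[of x] by (metis Compl_iff less_eq_real_def less_irrefl)
  have b: "\<eta> x \<le> \<bar>R\<bar> + norm z" for x
  proof (cases "x \<in> \<Omega>")
    case True
    have "\<eta> x \<le> dist x z"
      unfolding \<eta>_def using z by (intro infdist_le) auto
    also have "\<dots> \<le> norm x + norm z"
      unfolding dist_norm by (rule norm_triangle_ineq4)
    finally show ?thesis using R[OF True] by simp
  qed (simp add: z0)
  then show "\<exists>B. \<forall>x. \<eta> x \<le> B" by blast
  have lip: "\<bar>\<eta> x - \<eta> y\<bar> \<le> norm (x - y)" for x y
    using infdist_triangle_abs[of x "- \<Omega>" y] by (simp add: \<eta>_def dist_norm)
  have m: "\<eta> \<in> borel_measurable borel"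
    unfolding \<eta>_def by (intro borel_measurable_continuous_onI continuous_intros)
  show "\<eta> \<in> X0 s \<Omega>"
    by (rule lipschitz_in_X0[OF s _ _ m lip nonneg b z0])
      (use \<Omega>(1) emeasure_bounded_finite[OF \<Omega>(2)] in auto)
qed

lemma X0_bounded_integrable_powr:
  fixes v :: "'a::euclidean_space \<Rightarrow> real"
  assumes v: "v \<in> X0 s \<Omega>" and [measurable]: "\<Omega> \<in> sets borel" and fin: "emeasure lborel \<Omega> < \<infinity>"
    and b: "\<And>x. \<bar>v x\<bar> \<le> B" and r: "0 < r"
  shows "integrable lborel (\<lambda>x. \<bar>v x\<bar> powr r)"
proof (rule Bochner_Integration.integrable_bound)
  have [measurable]: "v \<in> borel_measurable lborel" using X0_measurable[OF v] .
  show "integrable lborel (\<lambda>x. B powr r * indicator \<Omega> x)"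
    using fin by (intro integrable_mult_right integrable_real_indicator) auto
  show "(\<lambda>x. \<bar>v x\<bar> powr r) \<in> borel_measurable lborel" by measurable
  show "AE x in lborel. norm (\<bar>v x\<bar> powr r) \<le> norm (B powr r * indicator \<Omega> x)"
    using X0_zero[OF v] by eventually_elim (use b r in \<open>auto simp: indicator_def intro!:
      powr_mono2\<close>)
qed

lemma admissible_nonempty:
  fixes \<Omega> :: "'a::euclidean_space set"
  assumes s: "0 < s" "s < 1" and \<Omega>: "open \<Omega>" "bounded \<Omega>" "\<Omega> \<noteq> {}" and p: "0 < p" "0 < q"
  shows "admissible s p q \<Omega> \<noteq> {}"
proof -
  let ?\<eta> = "\<lambda>x. infdist x (- \<Omega>)"
  note \<eta> = infdist_in_X0[OF s \<Omega>(1,2)]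
  obtain B where B: "\<And>x. ?\<eta> x \<le> B" using \<eta>(2) by blast
  have \<Omega>m: "\<Omega> \<in> sets borel" "emeasure lborel \<Omega> < \<infinity>"
    using \<Omega>(1) emeasure_bounded_finite[OF \<Omega>(2)] by auto
  have i: "integrable lborel (\<lambda>x. \<bar>?\<eta> x\<bar> powr r)" if "0 < r" for r
    using X0_bounded_integrable_powr[OF \<eta>(1) \<Omega>m _ that] B \<eta>(3) by auto
  define N where "N = (LINT x|lborel. \<bar>?\<eta> x\<bar> powr (p + 1))"
  have "0 \<le> N" unfolding N_def by (intro Bochner_Integration.integral_nonneg) auto
  moreover have "N \<noteq> 0"
  proof
    assume "N = 0"
    \<comment> \<open>A vanishing integral would make \<eta> vanish almost everywhere, hence make
      the nonempty open set \<Omega> null.\<close>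
    then have "AE x in lborel. \<bar>?\<eta> x\<bar> powr (p + 1) = 0"
      unfolding N_def using p by (subst (asm) integral_nonneg_eq_0_iff_AE[OF i]) auto
    then have "AE x in lborel. x \<notin> \<Omega>"
      by eventually_elim (use \<eta>(4) in force)
    then show False
      using AE_iff_null_sets[of \<Omega> lborel] \<Omega>m(1) open_not_negligible[OF \<Omega>(1,3)]
      by (auto simp: negligible_iff_null_sets null_sets_completionI)
  qed
  ultimately show ?thesis
    using admissible_normalize(1)[OF \<Omega>m(1) \<eta>(1) i N_def, of q] p by force
qed

section \<open>Compactness\<close>

text \<open>The kernel is left unnormalized: it is then 1-Lipschitz at every scale \<open>h\<close>,
  and its mass is comparable to h^{N+1}.\<close>

definition tent :: "real \<Rightarrow> 'a::euclidean_space \<Rightarrow> 'a \<Rightarrow> real" where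
  "tent h x y = max 0 (h - norm (x - y))"

definition tent_mean :: "real \<Rightarrow> ('a::euclidean_space \<Rightarrow> real) \<Rightarrow> 'a \<Rightarrow> real" where
  "tent_mean h v x = (LINT y|lborel. tent h x y * v y)"

lemma tent_bounds: "0 \<le> h \<Longrightarrow> 0 \<le> tent h x y \<and> tent h x y \<le> h"
  by (auto simp: tent_def)

lemma tent_lipschitz: "\<bar>tent h x y - tent h x' y\<bar> \<le> norm (x - x')"
proof -
  have "\<bar>norm (x - y) - norm (x' - y)\<bar> \<le> norm (x - x')"
    using norm_triangle_ineq3[of "x - y" "x' - y"] by simp
  then show ?thesis by (auto simp: tent_def)
qed

lemma tent_measurable [measurable]: "tent h x \<in> borel_measurable borel"
  unfolding tent_def by measurable

lemma tent_mult_integrable: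
  assumes h: "0 \<le> h" and v: "integrable lborel v"
  shows "integrable lborel (\<lambda>y. tent h x y * v y)"
proof (rule Bochner_Integration.integrable_bound)
  show "integrable lborel (\<lambda>y. h * v y)" using v by simp
  show "(\<lambda>y. tent h x y * v y) \<in> borel_measurable lborel"
    using v by measurable
  show "AE y in lborel. norm (tent h x y * v y) \<le> norm (h * v y)"
    using tent_bounds[OF h, of x] h by (auto simp: abs_mult intro!: mult_right_mono)
qed

lemma tent_mean_bound:
  assumes h: "0 \<le> h" and v: "integrable lborel v"
  shows "\<bar>tent_mean h v x\<bar> \<le> h * (LINT y|lborel. \<bar>v y\<bar>)"
proof -
  have "\<bar>tent_mean h v x\<bar> \<le> (LINT y|lborel. \<bar>tent h x y * v y\<bar>)"
    unfolding tent_mean_def by (rule integral_abs_bound)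
  also have "\<dots> \<le> (LINT y|lborel. h * \<bar>v y\<bar>)"
    using tent_mult_integrable[OF h v] tent_mult_integrable[OF h integrable_abs[OF v]] v
      tent_bounds[OF h, of x]
    by (intro integral_mono) (auto simp: abs_mult intro!: mult_right_mono)
  finally show ?thesis by simp
qed

text \<open>The Lipschitz constant depends neither on \<open>h\<close> nor on anything but the L^1
  norm, so the means of an L^1-bounded sequence are equicontinuous.\<close>

lemma tent_mean_lipschitz:
  assumes h: "0 \<le> h" and v: "integrable lborel v"
  shows "\<bar>tent_mean h v x - tent_mean h v x'\<bar> \<le> norm (x - x') * (LINT y|lborel. \<bar>v y\<bar>)"
proof -
  note i = tent_mult_integrable[OF h v]
  have "tent_mean h v x - tent_mean h v x' = (LINT y|lborel. tent h x y * v y - tent h x' y * v y)"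
    unfolding tent_mean_def using i by simp
  also have "\<bar>\<dots>\<bar> \<le> (LINT y|lborel. \<bar>tent h x y * v y - tent h x' y * v y\<bar>)"
    by (rule integral_abs_bound)
  also have "\<dots> \<le> (LINT y|lborel. norm (x - x') * \<bar>v y\<bar>)"
  proof (rule integral_mono)
    show "integrable lborel (\<lambda>y. \<bar>tent h x y * v y - tent h x' y * v y\<bar>)"
      using i by (intro integrable_abs Bochner_Integration.integrable_diff)
    fix y
    have "tent h x y * v y - tent h x' y * v y = (tent h x y - tent h x' y) * v y"
      by (simp add: algebra_simps)
    then show "\<bar>tent h x y * v y - tent h x' y * v y\<bar> \<le> norm (x - x') * \<bar>v y\<bar>"
      using tent_lipschitz[of h x y x'] by (simp add: abs_mult mult_right_mono)
  qed (use v in auto)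
  finally show ?thesis by simp
qed

lemma tent_mean_diff:
  assumes h: "0 \<le> h" and v: "integrable lborel v" "integrable lborel w"
  shows "tent_mean h (\<lambda>x. v x - w x) x = tent_mean h v x - tent_mean h w x"
  using tent_mult_integrable[OF h v(1), of x] tent_mult_integrable[OF h v(2), of x]
  by (simp add: tent_mean_def right_diff_distrib)

lemma tent_mean_measurable [measurable]:
  assumes h: "0 \<le> h" and v: "integrable lborel v"
  shows "tent_mean h v \<in> borel_measurable borel"
proof (rule borel_measurable_continuous_onI)
  let ?C = "LINT y|lborel. \<bar>v y\<bar>"
  have "?C-lipschitz_on UNIV (tent_mean h v)"
    by (rule lipschitz_onI)
      (use tent_mean_lipschitz[OF h v] in \<open>auto simp: dist_norm mult.commute\<close>)
  then show "continuous_on UNIV (tent_mean h v)"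
    by (rule lipschitz_on_continuous_on)
qed

text \<open>The kernel is at least h/2 on the ball of radius h/2.\<close>

lemma tent_mass_lower:
  fixes x :: "'a::euclidean_space"
  assumes h: "0 < h"
  shows "ennreal (unit_ball_vol (real DIM('a)) * (h / 2) ^ (DIM('a) + 1)) \<le> (\<integral>\<^sup>+y. ennreal (tent h
    x y) \<partial>lborel)"
proof -
  let ?V = "unit_ball_vol (real DIM('a))"
  have "ennreal (?V * (h / 2) ^ (DIM('a) + 1)) = ennreal (h / 2) * emeasure lborel (cball x (h /
    2))"
    using h by (simp add: emeasure_cball mult.commute mult.left_commute flip: ennreal_mult)
  also have "\<dots> = (\<integral>\<^sup>+y. ennreal (h / 2) * indicator (cball x (h / 2)) y \<partial>lborel)"
    by (subst nn_integral_cmult_indicator) auto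
  also have "\<dots> \<le> (\<integral>\<^sup>+y. ennreal (tent h x y) \<partial>lborel)"
    using h by (intro nn_integral_mono) (auto simp: tent_def indicator_def dist_norm intro!:
      ennreal_leI)
  finally show ?thesis .
qed

lemma tent_mass_upper:
  fixes x :: "'a::euclidean_space"
  assumes h: "0 < h"
  shows "(\<integral>\<^sup>+y. ennreal (tent h x y) \<partial>lborel) \<le> ennreal (unit_ball_vol (real DIM('a)) * h ^
    (DIM('a) + 1))"
proof -
  let ?V = "unit_ball_vol (real DIM('a))"
  have "(\<integral>\<^sup>+y. ennreal (tent h x y) \<partial>lborel) \<le> (\<integral>\<^sup>+y. ennreal h * indicator (cball x h) y \<partial>lborel)"
    using h by (intro nn_integral_mono) (auto simp: tent_def indicator_def dist_norm intro!:
      ennreal_leI)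
  also have "\<dots> = ennreal h * emeasure lborel (cball x h)"
    by (subst nn_integral_cmult_indicator) auto
  also have "\<dots> = ennreal (?V * h ^ (DIM('a) + 1))"
    using h by (simp add: emeasure_cball mult.commute mult.left_commute flip: ennreal_mult)
  finally show ?thesis .
qed

text \<open>Young's inequality with parameter \<delta> turns the first power of the difference into
  its square plus a constant. On the support of the kernel |x - y| < h, so the singular weight can
  be inserted at the price of h^{N+2s}, and the kernel itself contributes one more factor h.\<close>

lemma tent_mult_diff_le:
  fixes w :: "'a::euclidean_space \<Rightarrow> real"
  assumes h: "0 < h" and s: "0 < s" and \<delta>: "0 < \<delta>"
  shows "tent h x y * \<bar>w x - w y\<bar> \<le> \<delta> / 2 * tent h x y +
    h powr (1 + (real DIM('a) + 2 * s)) / (2 * \<delta>) * gker s w w (x, y)"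
proof -
  let ?a = "real DIM('a) + 2 * s"
  let ?d = "\<bar>w x - w y\<bar>"
  have "2 * (\<delta> * ?d) \<le> \<delta>\<^sup>2 + ?d\<^sup>2"
    using sum_squares_bound[of \<delta> ?d] by (simp add: mult.assoc)
  then have d: "?d \<le> \<delta> / 2 + ?d\<^sup>2 / (2 * \<delta>)"
    using \<delta> by (simp add: field_simps power2_eq_square)
  have t: "tent h x y * ?d\<^sup>2 \<le> h powr (1 + ?a) * gker s w w (x, y)"
  proof (cases "norm (x - y) < h \<and> x \<noteq> y")
    case True
    then have n: "0 < norm (x - y)" "norm (x - y) powr ?a \<le> h powr ?a"
      using s by (auto intro!: powr_mono2)
    have "tent h x y * norm (x - y) powr ?a \<le> h * h powr ?a"
      using n tent_bounds[of h x y] h by (intro mult_mono) auto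
    also have "\<dots> = h powr (1 + ?a)"
      using h by (simp add: powr_add)
    finally have "tent h x y * norm (x - y) powr ?a * ?d\<^sup>2 \<le> h powr (1 + ?a) * ?d\<^sup>2"
      by (rule mult_right_mono) simp
    then show ?thesis
      using n by (simp add: gker_def field_simps power2_eq_square)
  next
    \<comment> \<open>Either the kernel vanishes or the two points coincide and the difference
      does.\<close>
    case False
    then have "tent h x y * ?d\<^sup>2 = 0"
      by (auto simp: tent_def)
    moreover have "0 \<le> h powr (1 + ?a) * gker s w w (x, y)"
      by (simp add: gker_nonneg)
    ultimately show ?thesis by linarith
  qed
  have "tent h x y * ?d \<le> tent h x y * (\<delta> / 2 + ?d\<^sup>2 / (2 * \<delta>))"
    using d tent_bounds[of h x y] h by (intro mult_left_mono) auto
  also have "\<dots> = \<delta> / 2 * tent h x y + tent h x y * ?d\<^sup>2 / (2 * \<delta>)"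
    by (simp add: algebra_simps)
  also have "\<dots> \<le> \<delta> / 2 * tent h x y + h powr (1 + ?a) * gker s w w (x, y) / (2 * \<delta>)"
    using t \<delta> by (intro add_left_mono divide_right_mono) auto
  finally show ?thesis by simp
qed

text \<open>The kernel mass times w(x) is the mean plus the integral of
  \<open>tent h x y * (w x - w y)\<close>. The inequality is stated in \<open>ennreal\<close>
  because the inner Gagliardo integral may be infinite at exceptional points x.\<close>

lemma tent_mean_pointwise:
  fixes w :: "'a::euclidean_space \<Rightarrow> real"
  assumes h: "0 < h" and s: "0 < s" and \<delta>: "0 < \<delta>" and w: "integrable lborel w"
  defines "V \<equiv> unit_ball_vol (real DIM('a))"
  shows "ennreal (V * (h / 2) ^ (DIM('a) + 1) * \<bar>w x\<bar>) \<le>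
    ennreal \<bar>tent_mean h w x\<bar> + ennreal (\<delta> / 2 * (V * h ^ (DIM('a) + 1))) +
    ennreal (h powr (1 + (real DIM('a) + 2 * s)) / (2 * \<delta>)) * (\<integral>\<^sup>+y. ennreal (gker s w w (x, y))
      \<partial>lborel)"
proof -
  have [measurable]: "w \<in> borel_measurable borel" using w by simp
  let ?c = "h powr (1 + (real DIM('a) + 2 * s)) / (2 * \<delta>)"
  let ?T = "\<integral>\<^sup>+y. ennreal (tent h x y) \<partial>lborel"
  have t0: "0 \<le> tent h x y" for y using tent_bounds[of h x y] h by simp
  have g: "(\<lambda>y. gker s w w (x, y)) \<in> borel_measurable borel"
    unfolding gker_def by simp
  have Tfin: "?T < \<infinity>"
    using tent_mass_upper[OF h, of x] by (auto simp: less_top[symmetric] top_unique)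
  have it: "integrable lborel (tent h x)"
    by (rule integrableI_nonneg) (use Tfin t0 in auto)
  have i1: "integrable lborel (\<lambda>y. tent h x y * w y)"
    using tent_mult_integrable[of h w x] h w by simp
  have i2: "integrable lborel (\<lambda>y. tent h x y * (w x - w y))"
    using it i1 by (simp add: right_diff_distrib)
  let ?m = "LINT y|lborel. tent h x y"
  have V: "0 \<le> V" by (simp add: V_def)
  have "ennreal (V * (h / 2) ^ (DIM('a) + 1) * \<bar>w x\<bar>) = ennreal (V * (h / 2) ^ (DIM('a) + 1)) *
    ennreal \<bar>w x\<bar>"
    using h V by (intro ennreal_mult) auto
  also have "\<dots> \<le> ?T * ennreal \<bar>w x\<bar>"
    unfolding V_def by (intro mult_right_mono tent_mass_lower h) simp
  also have "\<dots> = ennreal (?m * \<bar>w x\<bar>)"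
    using it t0 by (simp add: nn_integral_eq_integral ennreal_mult
      Bochner_Integration.integral_nonneg)
  also have "?m * \<bar>w x\<bar> = \<bar>LINT y|lborel. tent h x y * w x\<bar>"
    using t0 by (simp add: abs_mult Bochner_Integration.integral_nonneg)
  also have "(LINT y|lborel. tent h x y * w x) = tent_mean h w x + (LINT y|lborel. tent h x y * (w
    x - w y))"
    unfolding tent_mean_def using i1 i2 by (simp add: algebra_simps flip:
      Bochner_Integration.integral_add)
  also have "ennreal \<bar>tent_mean h w x + (LINT y|lborel. tent h x y * (w x - w y))\<bar>
      \<le> ennreal \<bar>tent_mean h w x\<bar> + ennreal \<bar>LINT y|lborel. tent h x y * (w x - w y)\<bar>"
    by (simp flip: ennreal_plus)
  also have "ennreal \<bar>LINT y|lborel. tent h x y * (w x - w y)\<bar> \<le> (\<integral>\<^sup>+y. ennreal (tent h x y * \<bar>w x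
    - w y\<bar>) \<partial>lborel)"
    using integral_norm_bound_ennreal[OF i2] t0 by (simp add: abs_mult)
  also have "\<dots> \<le> (\<integral>\<^sup>+y. ennreal (\<delta> / 2) * ennreal (tent h x y) + ennreal ?c * ennreal (gker s w w
    (x, y)) \<partial>lborel)"
    using tent_mult_diff_le[OF h s \<delta>, of x _ w] t0 \<delta>
    by (intro nn_integral_mono) (simp add: gker_nonneg ennreal_leI flip: ennreal_mult ennreal_plus)
  also have "\<dots> = ennreal (\<delta> / 2) * ?T + ennreal ?c * (\<integral>\<^sup>+y. ennreal (gker s w w (x, y)) \<partial>lborel)"
    using g by (subst nn_integral_add) (auto simp: nn_integral_cmult)
  also have "ennreal (\<delta> / 2) * ?T \<le> ennreal (\<delta> / 2) * ennreal (V * h ^ (DIM('a) + 1))"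
    unfolding V_def by (intro mult_left_mono tent_mass_upper h) simp
  also have "\<dots> = ennreal (\<delta> / 2 * (V * h ^ (DIM('a) + 1)))"
    using \<delta> h V by (subst ennreal_mult) auto
  finally show ?thesis
    by (simp add: add_mono add.assoc)
qed

text \<open>The pointwise estimate is integrated; as w vanishes almost everywhere off \<Omega>, the
  first two terms may be restricted to \<Omega>. Relative to the factor of order h^{N+1} on the
  left, the second term is of order \<delta> and the last of order h^{2s}/\<delta>, which is how
  small \<delta> and then small h make both negligible.\<close>

lemma X0_L1_le_tent_mean:
  fixes w :: "'a::euclidean_space \<Rightarrow> real"
  assumes h: "0 < h" and s: "0 < s" and \<delta>: "0 < \<delta>"
    and \<Omega> [measurable]: "\<Omega> \<in> sets borel" and fin: "emeasure lborel \<Omega> < \<infinity>"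
    and w: "w \<in> X0 s \<Omega>" "integrable lborel w"
  defines "V \<equiv> unit_ball_vol (real DIM('a))"
  shows "V * (h / 2) ^ (DIM('a) + 1) * (LINT x|lborel. \<bar>w x\<bar>) \<le>
    (LINT x|lborel. indicator \<Omega> x * \<bar>tent_mean h w x\<bar>) +
    \<delta> / 2 * (V * h ^ (DIM('a) + 1)) * measure lborel \<Omega> +
    h powr (1 + (real DIM('a) + 2 * s)) / (2 * \<delta>) * gagliardo_form s w w"
proof -
  let ?k = "V * (h / 2) ^ (DIM('a) + 1)"
  let ?b = "\<delta> / 2 * (V * h ^ (DIM('a) + 1))"
  let ?c = "h powr (1 + (real DIM('a) + 2 * s)) / (2 * \<delta>)"
  have [measurable]: "w \<in> borel_measurable lborel" using X0_measurable[OF w(1)] .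
  have [measurable]: "tent_mean h w \<in> borel_measurable borel"
    using h w by (intro tent_mean_measurable) auto
  have V: "0 \<le> V" by (simp add: V_def)
  have k0: "0 \<le> ?k" "0 \<le> ?b" "0 \<le> ?c" using h V \<delta> by auto
  have iT: "integrable lborel (\<lambda>x. indicator \<Omega> x * \<bar>tent_mean h w x\<bar>)"
  proof (rule Bochner_Integration.integrable_bound)
    show "integrable lborel (\<lambda>x. (h * (LINT y|lborel. \<bar>w y\<bar>)) * indicator \<Omega> x)"
      using fin by (intro integrable_mult_right integrable_real_indicator) auto
    show "AE x in lborel. norm (indicator \<Omega> x * \<bar>tent_mean h w x\<bar>) \<le> norm ((h * (LINT y|lborel. \<bar>w
      y\<bar>)) * indicator \<Omega> x)"
      using tent_mean_bound[of h w] h w(2)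
      by (intro AE_I2) (auto simp: indicator_def abs_mult Bochner_Integration.integral_nonneg)
  qed measurable
  have "ennreal (?k * (LINT x|lborel. \<bar>w x\<bar>)) = ennreal (LINT x|lborel. ?k * \<bar>w x\<bar>)"
    by simp
  also have "\<dots> = (\<integral>\<^sup>+x. ennreal (?k * \<bar>w x\<bar>) \<partial>lborel)"
    using w(2) k0 by (intro nn_integral_eq_integral[symmetric]) auto
  also have "\<dots> \<le> (\<integral>\<^sup>+x. ennreal (indicator \<Omega> x * \<bar>tent_mean h w x\<bar>) + ennreal ?b * indicator \<Omega> x +
      ennreal ?c * (\<integral>\<^sup>+y. ennreal (gker s w w (x, y)) \<partial>lborel) \<partial>lborel)"
  proof (rule nn_integral_mono_AE)
    show "AE x in lborel. ennreal (?k * \<bar>w x\<bar>) \<le> ennreal (indicator \<Omega> x * \<bar>tent_mean h w x\<bar>) +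
      ennreal ?b * indicator \<Omega> x +
      ennreal ?c * (\<integral>\<^sup>+y. ennreal (gker s w w (x, y)) \<partial>lborel)"
      using X0_zero[OF w(1)]
    proof eventually_elim
      case (elim x)
      show ?case
        using elim tent_mean_pointwise[OF h s \<delta> w(2), of x]
        by (cases "x \<in> \<Omega>") (simp_all add: V_def)
    qed
  qed
  also have "\<dots> = (\<integral>\<^sup>+x. ennreal (indicator \<Omega> x * \<bar>tent_mean h w x\<bar>) \<partial>lborel) + ennreal ?b *
    emeasure lborel \<Omega> +
      ennreal ?c * (\<integral>\<^sup>+x. (\<integral>\<^sup>+y. ennreal (gker s w w (x, y)) \<partial>lborel) \<partial>lborel)"
    by (subst nn_integral_add, measurable, subst nn_integral_add, measurable,
        subst nn_integral_cmult_indicator, simp, subst nn_integral_cmult, measurable)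
  also have "(\<integral>\<^sup>+x. (\<integral>\<^sup>+y. ennreal (gker s w w (x, y)) \<partial>lborel) \<partial>lborel) = (\<integral>\<^sup>+z. ennreal (gker s
    w w z) \<partial>(lborel \<Otimes>\<^sub>M lborel))"
    by (rule lborel.nn_integral_fst) measurable
  also have "\<dots> = ennreal (gagliardo_form s w w)"
    unfolding gagliardo_form_gker using gker_integrable[OF X0_Hs[OF w(1)] X0_Hs[OF w(1)]]
    by (intro nn_integral_eq_integral) (auto simp: gker_nonneg)
  also have "(\<integral>\<^sup>+x. ennreal (indicator \<Omega> x * \<bar>tent_mean h w x\<bar>) \<partial>lborel) = ennreal (LINT x|lborel.
    indicator \<Omega> x * \<bar>tent_mean h w x\<bar>)"
    by (rule nn_integral_eq_integral[OF iT]) auto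
  also have "emeasure lborel \<Omega> = ennreal (measure lborel \<Omega>)"
    using fin by (intro emeasure_eq_ennreal_measure) auto
  also have "ennreal (LINT x|lborel. indicator \<Omega> x * \<bar>tent_mean h w x\<bar>) + ennreal ?b * ennreal
    (measure lborel \<Omega>) +
      ennreal ?c * ennreal (gagliardo_form s w w) =
    ennreal ((LINT x|lborel. indicator \<Omega> x * \<bar>tent_mean h w x\<bar>) + ?b * measure lborel \<Omega> + ?c *
      gagliardo_form s w w)"
  proof -
    have *: "ennreal A + ennreal b * ennreal m + ennreal c * ennreal g = ennreal (A + b * m + c *
      g)"
      if "0 \<le> A" "0 \<le> b" "0 \<le> m" "0 \<le> c" "0 \<le> g" for A b m c g
      using that by (simp flip: ennreal_mult ennreal_plus)
    show ?thesis
      using k0 by (intro * gagliardo_form_nonneg Bochner_Integration.integral_nonneg) auto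
  qed
  finally show ?thesis
  proof (subst (asm) ennreal_le_iff)
    show "0 \<le> (LINT x|lborel. indicator \<Omega> x * \<bar>tent_mean h w x\<bar>) + ?b * measure lborel \<Omega> + ?c *
      gagliardo_form s w w"
      by (intro add_nonneg_nonneg mult_nonneg_nonneg[OF k0(3)] mult_nonneg_nonneg[OF k0(2)]
          gagliardo_form_nonneg Bochner_Integration.integral_nonneg) auto
  qed
qed

section \<open>Extraction of a convergent subsequence\<close>

lemma gagliardo_form_diff_le:
  assumes u: "u \<in> Hs s" and v: "v \<in> Hs s"
  shows "gagliardo_form s (\<lambda>x. u x - v x) (\<lambda>x. u x - v x) \<le> 2 * gagliardo_form s u u + 2 *
    gagliardo_form s v v"
  using gagliardo_form_add_scale[OF u v, of "- 1"] gagliardo_form_add_scale[OF u v, of 1]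
    gagliardo_form_nonneg[of s "\<lambda>x. u x + 1 * v x"]
  by simp

lemma X0_diff:
  assumes "v \<in> X0 s \<Omega>" "w \<in> X0 s \<Omega>" shows "(\<lambda>x. v x - w x) \<in> X0 s \<Omega>"
  using X0_add[OF assms(1) X0_scale[OF assms(2), of "- 1"]] by simp

text \<open>An Arzela--Ascoli argument at all scales simultaneously: a diagonal sequence converges
  at every pair of a scale 1/(k+1) and a point of a countable dense set, and equicontinuity carries
  convergence to all points.\<close>

lemma tent_mean_converges:
  fixes v :: "nat \<Rightarrow> 'a::euclidean_space \<Rightarrow> real"
  assumes v: "\<And>n. integrable lborel (v n)" and C: "\<And>n. (LINT y|lborel. \<bar>v n y\<bar>) \<le> C"
  obtains r where "strict_mono (r :: nat \<Rightarrow> nat)"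
    "\<And>k x. convergent (\<lambda>n. tent_mean (1 / real (Suc k)) (v (r n)) x)"
proof -
  let ?h = "\<lambda>k. 1 / real (Suc k)"
  let ?f = "\<lambda>n z. tent_mean (?h (fst z)) (v n) (snd z)"
  obtain D :: "'a set" where D: "countable D" "\<And>X. open X \<Longrightarrow> X \<noteq> {} \<Longrightarrow> \<exists>d\<in>D. d \<in> X"
    using countable_dense_exists by metis
  have C0: "0 \<le> C"
    by (rule order_trans[OF _ C[of 0]]) (simp add: Bochner_Integration.integral_nonneg)
  have bound: "norm (?f n z) \<le> C" for n z
  proof -
    have "norm (?f n z) \<le> ?h (fst z) * (LINT y|lborel. \<bar>v n y\<bar>)"
      using tent_mean_bound[of "?h (fst z)" "v n"] v by simp
    also have "\<dots> \<le> 1 * C"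
      by (intro mult_mono C Bochner_Integration.integral_nonneg) auto
    finally show ?thesis by simp
  qed
  have "countable ((UNIV :: nat set) \<times> D)" using D(1) by simp
  then obtain r where r: "strict_mono (r :: nat \<Rightarrow> nat)"
      and lim: "\<And>z. z \<in> UNIV \<times> D \<Longrightarrow> \<exists>l. (\<lambda>n. ?f (r n) z) \<longlonglongrightarrow> l"
    by (rule function_convergent_subsequence[of _ ?f C]) (use bound in auto)
  have "Cauchy (\<lambda>n. tent_mean (?h k) (v (r n)) x)" for k x
  proof (rule metric_CauchyI)
    fix e :: real assume e: "0 < e"
    \<comment> \<open>The mean moves by at most \<open>\<epsilon> * C\<close> between x and a dense
      point within \<epsilon>; \<open>C + 1\<close> also covers C = 0.\<close>
    define \<epsilon> where "\<epsilon> = e / (3 * (C + 1))"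
    have \<epsilon>: "0 < \<epsilon>" using e C0 by (simp add: \<epsilon>_def)
    obtain d where d: "d \<in> D" "d \<in> ball x \<epsilon>"
      using D(2)[of "ball x \<epsilon>"] \<epsilon> by auto
    have near: "dist (tent_mean (?h k) (v n) x) (tent_mean (?h k) (v n) d) < e / 3" for n
    proof -
      have "dist (tent_mean (?h k) (v n) x) (tent_mean (?h k) (v n) d) \<le> norm (x - d) * (LINT
        y|lborel. \<bar>v n y\<bar>)"
        using tent_mean_lipschitz[of "?h k" "v n"] v by (simp add: dist_real_def)
      also have "\<dots> \<le> \<epsilon> * C"
        using d(2) \<epsilon> by (intro mult_mono C Bochner_Integration.integral_nonneg) (auto simp:
          dist_norm)
      also have "\<dots> < \<epsilon> * (C + 1)" using \<epsilon> by simp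
      also have "\<dots> = e / 3" using C0 by (simp add: \<epsilon>_def field_split_simps)
      finally show ?thesis .
    qed
    have "Cauchy (\<lambda>n. tent_mean (?h k) (v (r n)) d)"
      using lim[of "(k, d)"] d(1) LIMSEQ_imp_Cauchy by fastforce
    then obtain N where N: "\<And>m n. N \<le> m \<Longrightarrow> N \<le> n \<Longrightarrow>
        dist (tent_mean (?h k) (v (r m)) d) (tent_mean (?h k) (v (r n)) d) < e / 3"
      using metric_CauchyD[of _ "e / 3"] e by (metis divide_pos_pos zero_less_numeral)
    show "\<exists>N. \<forall>m\<ge>N. \<forall>n\<ge>N. dist (tent_mean (?h k) (v (r m)) x) (tent_mean (?h k) (v (r n)) x) < e"
    proof (intro exI[of _ N] allI impI)
      fix m n assume "N \<le> m" "N \<le> n"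
      from near[of "r m"] near[of "r n"] N[OF this]
      show "dist (tent_mean (?h k) (v (r m)) x) (tent_mean (?h k) (v (r n)) x) < e"
        unfolding dist_real_def by linarith
    qed
  qed
  then show thesis
    using that[OF r] Cauchy_convergent by blast
qed

text \<open>The means are bounded by \<open>h * C\<close> on a set of finite measure, so dominated
  convergence upgrades pointwise convergence to L^1 convergence on \<Omega>.\<close>

lemma tent_mean_L1_Cauchy:
  fixes v :: "nat \<Rightarrow> 'a::euclidean_space \<Rightarrow> real"
  assumes h: "0 < h" and \<Omega> [measurable]: "\<Omega> \<in> sets borel" and fin: "emeasure lborel \<Omega> < \<infinity>"
    and v: "\<And>n. integrable lborel (v n)" and C: "\<And>n. (LINT y|lborel. \<bar>v n y\<bar>) \<le> C"
    and conv: "\<And>x. convergent (\<lambda>n. tent_mean h (v n) x)"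
    and e: "0 < e"
  shows "\<exists>N. \<forall>i\<ge>N. \<forall>j\<ge>N. (LINT x|lborel. indicator \<Omega> x * \<bar>tent_mean h (\<lambda>y. v i y - v j y) x\<bar>) < e"
proof -
  have C0: "0 \<le> C"
    by (rule order_trans[OF _ C[of 0]]) (simp add: Bochner_Integration.integral_nonneg)
  define l where "l x = lim (\<lambda>n. tent_mean h (v n) x)" for x
  have lim: "(\<lambda>n. tent_mean h (v n) x) \<longlonglongrightarrow> l x" for x
    using conv unfolding l_def by (simp add: convergent_LIMSEQ_iff)
  have [measurable]: "tent_mean h (v n) \<in> borel_measurable borel" for n
    using h v by (intro tent_mean_measurable) auto
  have [measurable]: "l \<in> borel_measurable borel"
    by (rule borel_measurable_LIMSEQ_real[OF lim]) measurable
  have b: "\<bar>tent_mean h (v n) x\<bar> \<le> h * C" for n x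
  proof -
    have "\<bar>tent_mean h (v n) x\<bar> \<le> h * (LINT y|lborel. \<bar>v n y\<bar>)"
      using h v by (intro tent_mean_bound) auto
    also have "\<dots> \<le> h * C" using h C by (intro mult_left_mono) auto
    finally show ?thesis .
  qed
  have bl: "\<bar>l x\<bar> \<le> h * C" for x
    by (rule LIMSEQ_le_const2[OF tendsto_rabs[OF lim]]) (use b in auto)
  let ?d = "\<lambda>n x. indicator \<Omega> x * \<bar>tent_mean h (v n) x - l x\<bar>"
  have iB: "integrable lborel (\<lambda>x. (2 * (h * C)) * indicator \<Omega> x)"
    using fin by (intro integrable_mult_right integrable_real_indicator) auto
  have bd: "norm (?d n x) \<le> (2 * (h * C)) * indicator \<Omega> x" for n x
    using b[of n x] bl[of x] by (auto simp: indicator_def)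
  have id: "integrable lborel (?d n)" for n
  proof (rule Bochner_Integration.integrable_bound[OF iB])
    show "AE x in lborel. norm (?d n x) \<le> norm (2 * (h * C) * indicator \<Omega> x)"
      by (rule AE_I2, rule order_trans[OF bd]) simp
  qed measurable
  have d0: "AE x in lborel. (\<lambda>n. ?d n x) \<longlonglongrightarrow> 0"
  proof (rule AE_I2)
    fix x
    have "(\<lambda>n. tent_mean h (v n) x - l x) \<longlonglongrightarrow> 0"
      using lim[of x] by (simp add: LIM_zero)
    then show "(\<lambda>n. ?d n x) \<longlonglongrightarrow> 0"
      by (auto intro!: tendsto_mult_right_zero tendsto_rabs_zero)
  qed
  have "(\<lambda>n. LINT x|lborel. ?d n x) \<longlonglongrightarrow> (LINT x|(lborel :: 'a measure). 0)"
    by (rule integral_dominated_convergence[OF _ _ iB d0 AE_I2[OF bd]]) measurable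
  then have "(\<lambda>n. LINT x|lborel. ?d n x) \<longlonglongrightarrow> 0" by simp
  then obtain N where N: "\<And>n. N \<le> n \<Longrightarrow> (LINT x|lborel. ?d n x) < e / 2"
    using order_tendstoD(2)[of _ 0 sequentially "e / 2"] e
    by (auto simp: eventually_sequentially)
  show ?thesis
  proof (intro exI[of _ N] allI impI)
    fix i j assume ij: "N \<le> i" "N \<le> j"
    have "(LINT x|lborel. indicator \<Omega> x * \<bar>tent_mean h (\<lambda>y. v i y - v j y) x\<bar>) \<le> (LINT x|lborel.
      ?d i x + ?d j x)"
    proof (rule integral_mono_AE')
      show "integrable lborel (\<lambda>x. ?d i x + ?d j x)" using id by simp
      show "AE x in lborel. indicator \<Omega> x * \<bar>tent_mean h (\<lambda>y. v i y - v j y) x\<bar> \<le> ?d i x + ?d j x"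
        using h v by (intro AE_I2) (auto simp: tent_mean_diff indicator_def)
    qed auto
    also have "\<dots> = (LINT x|lborel. ?d i x) + (LINT x|lborel. ?d j x)"
      using id by simp
    also have "\<dots> < e" using N[OF ij(1)] N[OF ij(2)] by simp
    finally show "(LINT x|lborel. indicator \<Omega> x * \<bar>tent_mean h (\<lambda>y. v i y - v j y) x\<bar>) < e" .
  qed
qed

text \<open>The subsequence along which all means converge is shown to be Cauchy in L^1, by making
  each of the three terms of \<open>X0_L1_le_tent_mean\<close> at most \<kappa> e/3; a further
  subsequence then converges almost everywhere. The parameters are chosen in the order \<delta>, h,
  N.\<close>

lemma X0_AE_compactness:
  fixes v :: "nat \<Rightarrow> 'a::euclidean_space \<Rightarrow> real"
  assumes s: "0 < s" and \<Omega>: "\<Omega> \<in> sets borel" and fin: "emeasure lborel \<Omega> < \<infinity>"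
    and vX: "\<And>n. v n \<in> X0 s \<Omega>" and v: "\<And>n. integrable lborel (v n)"
    and C1: "\<And>n. (LINT y|lborel. \<bar>v n y\<bar>) \<le> C1" and C2: "\<And>n. gagliardo_form s (v n) (v n) \<le> C2"
  obtains r where "strict_mono (r :: nat \<Rightarrow> nat)" "AE x in lborel. convergent (\<lambda>n. v (r n) x)"
proof -
  let ?h = "\<lambda>k. 1 / real (Suc k)"
  let ?V = "unit_ball_vol (real DIM('a))"
  let ?a = "real DIM('a) + 2 * s"
  obtain r where r: "strict_mono (r :: nat \<Rightarrow> nat)"
    and conv: "\<And>k x. convergent (\<lambda>n. tent_mean (?h k) (v (r n)) x)"
    using tent_mean_converges[where v = v and C = C1, OF v C1] by blast
  have C20: "0 \<le> C2" using C2[of 0] gagliardo_form_nonneg[of s "v 0"] by linarith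
  have V: "0 < ?V" by simp
  have cauchy: "\<exists>N. \<forall>i\<ge>N. \<forall>j\<ge>N. (LINT x|lborel. norm (v (r i) x - v (r j) x)) < e" if e: "0 < e"
    for e
  proof -
    define m where "m = measure lborel \<Omega>"
    have m: "0 \<le> m" by (simp add: m_def)
    \<comment> \<open>After division by \<kappa> the second term is \<delta> 2^N m, whatever the
      scale; \<open>m + 1\<close> guards against measure 0.\<close>
    define \<delta> where "\<delta> = e / (3 * 2 ^ DIM('a) * (m + 1))"
    have \<delta>: "0 < \<delta>" using e m by (simp add: \<delta>_def)
    \<comment> \<open>With this constant the third term is \<kappa> times
      \<open>?Q * h powr (2 * s)\<close>: the power of 2 compares (h/2)^{N+1} with h^{N+1}, and 4 C2
      bounds the form of a difference of two members.\<close>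
    let ?Q = "2 ^ (DIM('a) + 1) * (4 * C2) / (2 * \<delta> * ?V)"
    have "(\<lambda>k. inverse (real (Suc k)) powr (2 * s)) \<longlonglongrightarrow> 0"
      using s by (intro tendsto_zero_powrI[OF LIMSEQ_inverse_real_of_nat tendsto_const]) auto
    then have "(\<lambda>k. ?Q * ?h k powr (2 * s)) \<longlonglongrightarrow> 0"
      by (intro tendsto_mult_right_zero) (simp add: inverse_eq_divide)
    then have "eventually (\<lambda>k. ?Q * ?h k powr (2 * s) < e / 3) sequentially"
      by (rule order_tendstoD) (use e in simp)
    then obtain k where k: "?Q * ?h k powr (2 * s) < e / 3"
      by (auto simp: eventually_sequentially)
    define h where "h = ?h k"
    have h: "0 < h" by (simp add: h_def)
    define \<kappa> where "\<kappa> = ?V * (h / 2) ^ (DIM('a) + 1)"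
    have \<kappa>: "0 < \<kappa>" using h V by (simp add: \<kappa>_def)
    have "\<exists>N. \<forall>i\<ge>N. \<forall>j\<ge>N. (LINT x|lborel. indicator \<Omega> x * \<bar>tent_mean h (\<lambda>y. v (r i) y - v (r j) y)
      x\<bar>) < \<kappa> * (e / 3)"
      using conv[of k] e \<kappa> by (intro tent_mean_L1_Cauchy[OF h \<Omega> fin v C1]) (auto simp: h_def)
    then obtain N where N: "\<And>i j. N \<le> i \<Longrightarrow> N \<le> j \<Longrightarrow>
        (LINT x|lborel. indicator \<Omega> x * \<bar>tent_mean h (\<lambda>y. v (r i) y - v (r j) y) x\<bar>) < \<kappa> * (e / 3)"
      by blast
    have p2: "\<kappa> * 2 ^ (DIM('a) + 1) = ?V * h ^ (DIM('a) + 1)"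
      by (simp add: \<kappa>_def power_divide)
    have t2: "\<delta> / 2 * (?V * h ^ (DIM('a) + 1)) * m \<le> \<kappa> * (e / 3)"
    proof -
      have "\<delta> / 2 * (?V * h ^ (DIM('a) + 1)) * m = \<kappa> * (\<delta> * 2 ^ DIM('a) * m)"
        unfolding p2[symmetric] by simp
      also have "\<dots> \<le> \<kappa> * (\<delta> * 2 ^ DIM('a) * (m + 1))"
        using \<kappa> \<delta> by simp
      also have "\<delta> * 2 ^ DIM('a) * (m + 1) = e / 3"
      proof -
        have "e / (3 * M * k) * M * k = e / 3" if "M \<noteq> 0" "k \<noteq> 0" for M k :: real
          using that by simp
        from this[of "2 ^ DIM('a)" "m + 1"] show ?thesis
          using m by (simp add: \<delta>_def)
      qed
      finally show ?thesis .
    qed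
    have t3: "h powr (1 + ?a) / (2 * \<delta>) * (4 * C2) < \<kappa> * (e / 3)"
    proof -
      have "h powr (1 + ?a) = h ^ (DIM('a) + 1) * h powr (2 * s)"
        using h by (simp add: powr_add powr_realpow)
      also have "\<dots> = \<kappa> * (2 ^ (DIM('a) + 1) / ?V * h powr (2 * s))"
      proof -
        have "h ^ (DIM('a) + 1) = \<kappa> * 2 ^ (DIM('a) + 1) / ?V"
          unfolding p2 using less_imp_neq[OF V] by simp
        then show ?thesis by simp
      qed
      finally have "h powr (1 + ?a) / (2 * \<delta>) * (4 * C2) = \<kappa> * (?Q * h powr (2 * s))"
        by (simp add: field_simps)
      also have "\<dots> < \<kappa> * (e / 3)"
        using k \<kappa> by (intro mult_strict_left_mono) (auto simp: h_def)
      finally show ?thesis .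
    qed
    show ?thesis
    proof (intro exI[of _ N] allI impI)
      fix i j assume ij: "N \<le> i" "N \<le> j"
      let ?w = "\<lambda>x. v (r i) x - v (r j) x"
      have w: "?w \<in> X0 s \<Omega>" "integrable lborel ?w"
        using X0_diff[OF vX vX] v by auto
      have "gagliardo_form s ?w ?w \<le> 4 * C2"
        using gagliardo_form_diff_le[OF X0_Hs[OF vX] X0_Hs[OF vX], of "r i" "r j"] C2[of "r i"]
          C2[of "r j"] by linarith
      then have "h powr (1 + ?a) / (2 * \<delta>) * gagliardo_form s ?w ?w \<le> h powr (1 + ?a) / (2 * \<delta>) *
        (4 * C2)"
        using \<delta> by (intro mult_left_mono) auto
      then have "\<kappa> * (LINT x|lborel. \<bar>?w x\<bar>) < \<kappa> * (e / 3) + \<kappa> * (e / 3) + \<kappa> * (e / 3)"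
        using X0_L1_le_tent_mean[OF h s \<delta> \<Omega> fin w] N[OF ij] t2 t3
        unfolding \<kappa>_def[symmetric] m_def[symmetric] by linarith
      also have "\<dots> = \<kappa> * e" by (simp add: field_simps)
      finally show "(LINT x|lborel. norm (?w x)) < e"
        using \<kappa> by simp
    qed
  qed
  obtain r' where r': "strict_mono (r' :: nat \<Rightarrow> nat)" "AE x in lborel. Cauchy (\<lambda>i. v (r (r' i)) x)"
    by (rule cauchy_L1_AE_cauchy_subseq[of lborel "\<lambda>i. v (r i)"]) (use v cauchy in auto)
  show thesis
  proof (rule that)
    show "strict_mono (r \<circ> r')" by (rule strict_mono_o[OF r r'(1)])
    show "AE x in lborel. convergent (\<lambda>n. v ((r \<circ> r') n) x)"
      using r'(2) by eventually_elim (simp add: Cauchy_convergent)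
  qed
qed

section \<open>Existence of a minimizer\<close>

text \<open>The bounds \<open>c n\<close> are kept apart from the integrals so that they may come
  from another sequence; the maximum principle bounds one family of integrals by a second,
  convergent one.\<close>

lemma Fatou_integral_le:
  fixes f :: "nat \<Rightarrow> 'a \<Rightarrow> real"
  assumes f: "\<And>n. integrable M (f n)" and nonneg: "\<And>n x. 0 \<le> f n x"
    and [measurable]: "g \<in> borel_measurable M" and lim: "AE x in M. (\<lambda>n. f n x) \<longlonglongrightarrow> g x"
    and le: "\<And>n. (LINT x|M. f n x) \<le> c n" and c: "c \<longlonglongrightarrow> a"
  shows "integrable M g" and "(LINT x|M. g x) \<le> a"
proof -
  have g0: "AE x in M. 0 \<le> g x"
    using lim by eventually_elim (auto intro: LIMSEQ_le_const nonneg)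
  have "(\<integral>\<^sup>+x. ennreal (g x) \<partial>M) = (\<integral>\<^sup>+x. liminf (\<lambda>n. ennreal (f n x)) \<partial>M)"
  proof (rule nn_integral_cong_AE)
    show "AE x in M. ennreal (g x) = liminf (\<lambda>n. ennreal (f n x))"
      using lim by eventually_elim (metis lim_imp_Liminf sequentially_bot tendsto_ennrealI)
  qed
  also have "\<dots> \<le> liminf (\<lambda>n. \<integral>\<^sup>+x. ennreal (f n x) \<partial>M)"
    using f by (intro nn_integral_liminf) auto
  also have "\<dots> \<le> liminf (\<lambda>n. ennreal (c n))"
    using f nonneg le
    by (intro Liminf_mono always_eventually allI) (subst nn_integral_eq_integral, auto intro!:
      ennreal_leI)
  also have "\<dots> = ennreal a"
    using c by (metis lim_imp_Liminf sequentially_bot tendsto_ennrealI)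
  finally have le': "(\<integral>\<^sup>+x. ennreal (g x) \<partial>M) \<le> ennreal a" .
  show "integrable M g"
    by (rule integrableI_nonneg) (use g0 le' in \<open>auto intro: le_less_trans\<close>)
  then have "ennreal (LINT x|M. g x) \<le> ennreal a"
    using le' g0 by (simp add: nn_integral_eq_integral)
  moreover have "0 \<le> a"
  proof (rule LIMSEQ_le_const[OF c])
    have "0 \<le> (LINT x|M. f n x)" for n
      using nonneg by (intro Bochner_Integration.integral_nonneg)
    then show "\<exists>N. \<forall>n\<ge>N. 0 \<le> c n"
      using le order_trans by blast
  qed
  ultimately show "(LINT x|M. g x) \<le> a"
    by simp
qed

text \<open>The exceptional pairs lie in two strips over a null set, both null in the product. This
  transfers almost everywhere convergence to the Gagliardo integrand.\<close>

lemma AE_lborel_pair: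
  assumes "AE x in (lborel :: 'a::euclidean_space measure). A x"
  shows "AE z in lborel \<Otimes>\<^sub>M (lborel :: 'a measure). A (fst z) \<and> A (snd z)"
proof -
  obtain N where N: "{x. \<not> A x} \<subseteq> N" "N \<in> sets borel" "emeasure lborel N = 0"
    using assms by (auto elim!: AE_E)
  have "AE z in lborel \<Otimes>\<^sub>M (lborel :: 'a measure). z \<notin> N \<times> UNIV \<union> UNIV \<times> N"
  proof (rule AE_not_in)
    have "N \<times> UNIV \<in> null_sets (lborel \<Otimes>\<^sub>M (lborel :: 'a measure))"
      using N by (intro null_setsI) (auto simp: lborel.emeasure_pair_measure_Times)
    moreover have "UNIV \<times> N \<in> null_sets (lborel \<Otimes>\<^sub>M (lborel :: 'a measure))"
      using N by (intro null_setsI) (auto simp: lborel.emeasure_pair_measure_Times)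
    ultimately show "N \<times> UNIV \<union> UNIV \<times> N \<in> null_sets (lborel \<Otimes>\<^sub>M (lborel :: 'a measure))"
      by (rule null_sets.Un)
  qed
  then show ?thesis
    by eventually_elim (use N(1) in auto)
qed

text \<open>Above height k the factor |t|^{a-b} is at most k^{a-b}, since a < b.\<close>

lemma powr_truncation_error:
  fixes t k a b :: real
  assumes "0 < a" "a < b" "0 < k"
  shows "min \<bar>t\<bar> k powr a \<le> \<bar>t\<bar> powr a"
    and "\<bar>t\<bar> powr a - min \<bar>t\<bar> k powr a \<le> k powr (a - b) * \<bar>t\<bar> powr b"
proof -
  show "min \<bar>t\<bar> k powr a \<le> \<bar>t\<bar> powr a"
    using assms by (intro powr_mono2) auto
  show "\<bar>t\<bar> powr a - min \<bar>t\<bar> k powr a \<le> k powr (a - b) * \<bar>t\<bar> powr b"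
  proof (cases "\<bar>t\<bar> \<le> k")
    case False
    then have "\<bar>t\<bar> powr (a - b) \<le> k powr (a - b)"
      using assms by (intro powr_mono2') auto
    then have "\<bar>t\<bar> powr (a - b) * \<bar>t\<bar> powr b \<le> k powr (a - b) * \<bar>t\<bar> powr b"
      by (rule mult_right_mono) simp
    then have "\<bar>t\<bar> powr a \<le> k powr (a - b) * \<bar>t\<bar> powr b"
      using False assms by (simp flip: powr_add)
    then show ?thesis
      by (rule order_trans[rotated]) simp
  qed auto
qed

text \<open>A case of Vitali's theorem: the bound in L^b makes the a-th powers uniformly integrable.
  Here truncation at height k leaves an error of at most C k^{a-b}, uniformly in n, and the
  truncated integrals converge by domination.\<close>

lemma tendsto_integral_powr_subcritical:
  fixes v :: "nat \<Rightarrow> 'a::euclidean_space \<Rightarrow> real"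
  assumes [measurable]: "\<And>n. v n \<in> borel_measurable lborel" "u \<in> borel_measurable lborel"
    and \<Omega> [measurable]: "\<Omega> \<in> sets borel" and fin: "emeasure lborel \<Omega> < \<infinity>"
    and zv: "\<And>n. AE x in lborel. x \<notin> \<Omega> \<longrightarrow> v n x = 0" and zu: "AE x in lborel. x \<notin> \<Omega> \<longrightarrow> u x = 0"
    and lim: "AE x in lborel. (\<lambda>n. v n x) \<longlonglongrightarrow> u x"
    and ab: "0 < a" "a < b"
    and iv: "\<And>n. integrable lborel (\<lambda>x. \<bar>v n x\<bar> powr b)" and iu: "integrable lborel (\<lambda>x. \<bar>u x\<bar>
      powr b)"
    and cv: "\<And>n. (LINT x|lborel. \<bar>v n x\<bar> powr b) \<le> C" and cu: "(LINT x|lborel. \<bar>u x\<bar> powr b) \<le> C"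
  shows "(\<lambda>n. LINT x|lborel. \<bar>v n x\<bar> powr a) \<longlonglongrightarrow> (LINT x|lborel. \<bar>u x\<bar> powr a)"
proof (rule LIMSEQ_I)
  fix e :: real assume e: "0 < e"
  have C0: "0 \<le> C"
    by (rule order_trans[OF _ cu]) (simp add: Bochner_Integration.integral_nonneg)
  have "((\<lambda>k. C * k powr (a - b)) \<longlongrightarrow> C * 0) at_top"
    using ab by (intro tendsto_mult tendsto_const tendsto_neg_powr filterlim_ident) auto
  then have "eventually (\<lambda>k. C * k powr (a - b) < e / 2) at_top"
    by (rule order_tendstoD) (use e in simp)
  then have "eventually (\<lambda>k. C * k powr (a - b) < e / 2 \<and> 0 < k) at_top"
    by (intro eventually_conj eventually_gt_at_top)
  then obtain k where k: "C * k powr (a - b) < e / 2" "0 < k"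
    using eventually_happens[of _ "at_top :: real filter"] by auto
  let ?T = "\<lambda>w x. min \<bar>w x\<bar> k powr a"
  have tail: "integrable lborel (\<lambda>x. \<bar>w x\<bar> powr a) \<and>
      0 \<le> (LINT x|lborel. \<bar>w x\<bar> powr a) - (LINT x|lborel. ?T w x) \<and>
      (LINT x|lborel. \<bar>w x\<bar> powr a) - (LINT x|lborel. ?T w x) < e / 2"
    if [measurable]: "w \<in> borel_measurable lborel" and "AE x in lborel. x \<notin> \<Omega> \<longrightarrow> w x = 0"
      "integrable lborel (\<lambda>x. \<bar>w x\<bar> powr b)" "(LINT x|lborel. \<bar>w x\<bar> powr b) \<le> C" for w
  proof -
    have i: "integrable lborel (\<lambda>x. \<bar>w x\<bar> powr a)"
      using integrable_powr_smaller_exponent[OF that(1,2) \<Omega> fin that(3) ab(1)] ab(2) by simp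
    have iT: "integrable lborel (?T w)"
      by (rule Bochner_Integration.integrable_bound[OF i])
        (use powr_truncation_error(1)[OF ab k(2)] in auto)
    have 0: "0 \<le> (LINT x|lborel. \<bar>w x\<bar> powr a - ?T w x)"
      using powr_truncation_error(1)[OF ab k(2)] by (intro Bochner_Integration.integral_nonneg) simp
    have "(LINT x|lborel. \<bar>w x\<bar> powr a - ?T w x) \<le> (LINT x|lborel. k powr (a - b) * \<bar>w x\<bar> powr b)"
      using i iT that(3) powr_truncation_error(2)[OF ab k(2)]
      by (intro integral_mono Bochner_Integration.integrable_diff integrable_mult_right) auto
    also have "\<dots> \<le> k powr (a - b) * C"
      using that(4) by (simp add: mult_left_mono)
    also have "\<dots> < e / 2" using k by (simp add: mult.commute)
    finally show ?thesis using 0 i iT by simp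
  qed
  have "(\<lambda>n. LINT x|lborel. ?T (v n) x) \<longlonglongrightarrow> (LINT x|lborel. ?T u x)"
  proof (rule integral_dominated_convergence)
    show "integrable lborel (\<lambda>x. k powr a * indicator \<Omega> x)"
      using fin by (intro integrable_mult_right integrable_real_indicator) auto
    show "AE x in lborel. (\<lambda>n. ?T (v n) x) \<longlonglongrightarrow> ?T u x"
      using lim by eventually_elim (use ab in \<open>auto intro!: tendsto_powr' tendsto_min tendsto_rabs
        tendsto_const\<close>)
    show "AE x in lborel. norm (?T (v n) x) \<le> k powr a * indicator \<Omega> x" for n
      using zv[of n] by eventually_elim (use ab k in \<open>auto simp: indicator_def intro!: powr_mono2\<close>)
  qed measurable
  from LIMSEQ_D[OF this, of "e / 2"] e
  obtain N where N: "\<And>n. N \<le> n \<Longrightarrow> \<bar>(LINT x|lborel. ?T (v n) x) - (LINT x|lborel. ?T u x)\<bar> < e / 2"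
    by auto
  show "\<exists>N. \<forall>n\<ge>N. norm ((LINT x|lborel. \<bar>v n x\<bar> powr a) - (LINT x|lborel. \<bar>u x\<bar> powr a)) < e"
  proof (intro exI[of _ N] allI impI)
    fix n assume "N \<le> n"
    \<comment> \<open>Both truncation errors lie in [0, e/2), so their difference is below e/2 in
      absolute value; together with the truncated integrals this stays below e.\<close>
    from N[OF this] tail[OF assms(1) zv iv cv, of n] tail[OF assms(2) zu iu cu]
    show "norm ((LINT x|lborel. \<bar>v n x\<bar> powr a) - (LINT x|lborel. \<bar>u x\<bar> powr a)) < e"
      unfolding real_norm_def by linarith
  qed
qed

section \<open>The direct method\<close>

lemma energy_nonneg: "0 < q \<Longrightarrow> 0 \<le> energy s q v \<Omega>"
  unfolding energy_alt set_lebesgue_integral_def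
  by (intro add_nonneg_nonneg divide_nonneg_nonneg gagliardo_form_nonneg
    Bochner_Integration.integral_nonneg)
    auto

lemma S_inf_le_energy:
  assumes "0 < q" "v \<in> admissible s p q \<Omega>"
  shows "S_inf s p q \<Omega> \<le> energy s q v \<Omega>"
  unfolding S_inf_def using assms energy_nonneg
  by (intro cINF_lower) (auto intro!: bdd_belowI2)

lemma minimizer_exists:
  fixes \<Omega> :: "'a::euclidean_space set"
  assumes s: "0 < s" and \<Omega> [measurable]: "\<Omega> \<in> sets borel" and fin: "emeasure lborel \<Omega> < \<infinity>"
    and p: "1 < p" "p < q" and ne: "admissible s p q \<Omega> \<noteq> {}"
  obtains u where "u \<in> admissible s p q \<Omega>" "energy s q u \<Omega> = S_inf s p q \<Omega>"
proof -
  let ?S = "S_inf s p q \<Omega>"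
  have q: "0 < q" using p by simp
  have "\<exists>v. v \<in> admissible s p q \<Omega> \<and> energy s q v \<Omega> < ?S + 1 / real (Suc n)" for n
  proof -
    have "(INF v\<in>admissible s p q \<Omega>. energy s q v \<Omega>) < ?S + 1 / real (Suc n)"
      by (simp add: S_inf_def)
    then show ?thesis
      using energy_nonneg[OF q] by (subst (asm) cINF_less_iff[OF ne]) (auto intro!: bdd_belowI2)
  qed
  then obtain v where v: "\<And>n. v n \<in> admissible s p q \<Omega>"
      and ve: "\<And>n. energy s q (v n) \<Omega> < ?S + 1 / real (Suc n)"
    by metis
  have vX: "v n \<in> X0 s \<Omega>" and iv: "integrable lborel (\<lambda>x. \<bar>v n x\<bar> powr (q + 1))"
    and v1: "(LINT x|lborel. \<bar>v n x\<bar> powr (p + 1)) = 1" for n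
    using v[of n] unfolding admissible_iff[OF \<Omega>] by auto
  note [measurable] = X0_measurable[OF vX]
  define a where "a n = gagliardo_form s (v n) (v n)" for n
  define b where "b n = (LINT x|lborel. \<bar>v n x\<bar> powr (q + 1))" for n
  have a0: "0 \<le> a n" and b0: "0 \<le> b n" for n
    by (auto simp: a_def b_def gagliardo_form_nonneg Bochner_Integration.integral_nonneg)
  have en: "energy s q (v n) \<Omega> = a n / 2 + b n / (q + 1)" for n
    unfolding energy_X0[OF \<Omega> vX] a_def b_def ..
  have ab: "a n / 2 + b n / (q + 1) \<le> ?S + 1" for n
  proof -
    have "1 / real (Suc n) \<le> 1" by simp
    then show ?thesis using ve[of n] en[of n] by linarith
  qed
  have aC: "a n \<le> 2 * (?S + 1)" for n
    using ab[of n] b0[of n] q by (smt (verit) divide_nonneg_nonneg field_sum_of_halves)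
  have bC: "b n \<le> (q + 1) * (?S + 1)" for n
  proof -
    have "b n / (q + 1) \<le> ?S + 1" using ab[of n] a0[of n] by linarith
    then show ?thesis using q by (simp add: field_simps)
  qed
  have iv1: "integrable lborel (\<lambda>x. \<bar>v n x\<bar>)" for n
    using X0_integrable_powr[OF vX vX \<Omega> fin iv, of 1 n] q by (simp add: powr_one)
  \<comment> \<open>From |t| \<le> 1 + |t|^{q+1}, with the 1 charged to \<Omega> only.\<close>
  have L1: "(LINT x|lborel. \<bar>v n x\<bar>) \<le> measure lborel \<Omega> + (q + 1) * (?S + 1)" for n
  proof -
    have ii: "integrable lborel (indicator \<Omega> :: 'a \<Rightarrow> real)"
      using fin by (intro integrable_real_indicator) auto
    have "(LINT x|lborel. \<bar>v n x\<bar>) \<le> (LINT x|lborel. indicator \<Omega> x + \<bar>v n x\<bar> powr (q + 1))"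
    proof (rule integral_mono_AE[OF iv1 Bochner_Integration.integrable_add[OF ii iv]])
      show "AE x in lborel. \<bar>v n x\<bar> \<le> indicator \<Omega> x + \<bar>v n x\<bar> powr (q + 1)"
        using X0_zero[OF vX[of n]]
      proof eventually_elim
        case (elim x)
        have "\<bar>v n x\<bar> \<le> \<bar>v n x\<bar> powr (q + 1)" if "1 \<le> \<bar>v n x\<bar>"
          using that powr_mono[of 1 "q + 1" "\<bar>v n x\<bar>"] q by simp
        then show ?case
          using elim by (cases "x \<in> \<Omega>"; cases "1 \<le> \<bar>v n x\<bar>") (auto intro: add_increasing2)
      qed
    qed
    also have "\<dots> = measure lborel \<Omega> + b n"
      using ii iv by (simp add: b_def)
    finally show ?thesis using bC[of n] by linarith
  qed
  obtain r1 where r1: "strict_mono (r1 :: nat \<Rightarrow> nat)" "AE x in lborel. convergent (\<lambda>n. v (r1 n) x)"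
    by (rule X0_AE_compactness[where v = v, OF s \<Omega> fin vX _ L1 aC[unfolded a_def]])
      (use iv1 integrable_norm_iff[of "v _" lborel] in auto)
  \<comment> \<open>Both parts of the energy are made to converge separately, so that Fatou's lemma
    can be applied to each of them.\<close>
  have "bounded (range (\<lambda>n. (a (r1 n), b (r1 n))))"
  proof (rule bounded_subset)
    show "bounded ({0..2 * (?S + 1)} \<times> {0..(q + 1) * (?S + 1)})"
      by (intro bounded_Times bounded_closed_interval)
    show "range (\<lambda>n. (a (r1 n), b (r1 n))) \<subseteq> {0..2 * (?S + 1)} \<times> {0..(q + 1) * (?S + 1)}"
      using a0 b0 aC bC by auto
  qed
  then obtain l r2 where r2: "strict_mono (r2 :: nat \<Rightarrow> nat)"
      and l: "((\<lambda>n. (a (r1 n), b (r1 n))) \<circ> r2) \<longlonglongrightarrow> l"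
    using bounded_imp_convergent_subsequence by metis
  define r where "r n = r1 (r2 n)" for n
  have la: "(\<lambda>n. a (r n)) \<longlonglongrightarrow> fst l" and lb: "(\<lambda>n. b (r n)) \<longlonglongrightarrow> snd l"
    using tendsto_fst[OF l] tendsto_snd[OF l] by (simp_all add: r_def o_def)
  \<comment> \<open>On the null set where the limit fails to exist the value is arbitrary;
    measurability holds regardless.\<close>
  define u where "u x = lim (\<lambda>n. v (r n) x)" for x
  have lim: "AE x in lborel. (\<lambda>n. v (r n) x) \<longlonglongrightarrow> u x"
    using r1(2)
  proof eventually_elim
    case (elim x)
    from convergent_subseq_convergent[OF elim r2]
    show ?case by (simp add: u_def r_def o_def convergent_LIMSEQ_iff)
  qed
  have [measurable]: "u \<in> borel_measurable lborel"
    unfolding u_def by (rule borel_measurable_lim_metric) measurable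
  have "AE x in lborel. \<forall>n. x \<notin> \<Omega> \<longrightarrow> v (r n) x = 0"
    unfolding AE_all_countable using X0_zero[OF vX] by blast
  with lim have zu: "AE x in lborel. x \<notin> \<Omega> \<longrightarrow> u x = 0"
  proof eventually_elim
    case (elim x)
    then show ?case using LIMSEQ_unique[OF _ tendsto_const[of 0]] by auto
  qed
  have limq: "AE x in lborel. (\<lambda>n. \<bar>v (r n) x\<bar> powr (q + 1)) \<longlonglongrightarrow> \<bar>u x\<bar> powr (q + 1)"
    using lim by eventually_elim (use q in \<open>auto intro!: tendsto_powr' tendsto_rabs tendsto_const\<close>)
  have iu: "integrable lborel (\<lambda>x. \<bar>u x\<bar> powr (q + 1))"
    and bu: "(LINT x|lborel. \<bar>u x\<bar> powr (q + 1)) \<le> snd l"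
    using Fatou_integral_le[OF iv _ _ limq _ lb] by (auto simp: b_def)
  have limg: "AE z in lborel \<Otimes>\<^sub>M lborel. (\<lambda>n. gker s (v (r n)) (v (r n)) z) \<longlonglongrightarrow> gker s u u z"
    using AE_lborel_pair[OF lim]
  proof eventually_elim
    case (elim z)
    then show ?case
      unfolding gker_def case_prod_beta divide_inverse
      by (intro tendsto_mult tendsto_diff tendsto_const) auto
  qed
  have ig: "integrable (lborel \<Otimes>\<^sub>M lborel) (gker s u u)" and gu: "gagliardo_form s u u \<le> fst l"
    unfolding gagliardo_form_gker
    using Fatou_integral_le[OF gker_integrable[OF X0_Hs[OF vX] X0_Hs[OF vX]] gker_nonneg _ limg _
      la]
    by (auto simp: a_def gagliardo_form_gker)
  \<comment> \<open>Square integrability follows from 2 \<le> q + 1 and the finite measure of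
    \<Omega>.\<close>
  have "integrable lborel (\<lambda>x. \<bar>u x\<bar> powr 2)"
    by (rule integrable_powr_smaller_exponent[OF _ zu \<Omega> fin iu]) (use p in auto)
  then have uX: "u \<in> X0 s \<Omega>"
    using ig zu by (simp add: X0_def Hs_iff)
  have "(\<lambda>n. LINT x|lborel. \<bar>v (r n) x\<bar> powr (p + 1)) \<longlonglongrightarrow> (LINT x|lborel. \<bar>u x\<bar> powr (p + 1))"
  proof (rule tendsto_integral_powr_subcritical[OF _ _ \<Omega> fin X0_zero[OF vX] zu lim _ _ iv iu])
    show "(LINT x|lborel. \<bar>v (r n) x\<bar> powr (q + 1)) \<le> (q + 1) * (?S + 1)" for n
      using bC[of "r n"] by (simp add: b_def)
    show "(LINT x|lborel. \<bar>u x\<bar> powr (q + 1)) \<le> (q + 1) * (?S + 1)"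
      using bu LIMSEQ_le_const2[OF lb] bC order_trans by blast
  qed (use p in auto)
  then have "(LINT x|lborel. \<bar>u x\<bar> powr (p + 1)) = 1"
    unfolding v1 by (simp add: LIMSEQ_const_iff)
  then have u: "u \<in> admissible s p q \<Omega>"
    unfolding admissible_iff[OF \<Omega>] using uX iu by simp
  have "strict_mono r"
    using strict_mono_o[OF r1(1) r2] by (simp add: r_def[abs_def] o_def)
  have "(\<lambda>n. ?S + inverse (real (Suc n))) \<longlonglongrightarrow> ?S + 0"
    by (intro tendsto_add tendsto_const LIMSEQ_inverse_real_of_nat)
  then have "(\<lambda>n. ?S + inverse (real (Suc (r n)))) \<longlonglongrightarrow> ?S"
    using LIMSEQ_subseq_LIMSEQ[OF _ \<open>strict_mono r\<close>] by (fastforce simp: o_def)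
  moreover have "(\<lambda>n. a (r n) / 2 + b (r n) / (q + 1)) \<longlonglongrightarrow> fst l / 2 + snd l / (q + 1)"
    using q by (intro tendsto_add tendsto_divide la lb tendsto_const) auto
  ultimately have "fst l / 2 + snd l / (q + 1) \<le> ?S"
    using ve en by (intro LIMSEQ_le) (auto simp: inverse_eq_divide intro!: less_imp_le)
  moreover have "energy s q u \<Omega> \<le> fst l / 2 + snd l / (q + 1)"
    unfolding energy_X0[OF \<Omega> uX] using gu bu q by (intro add_mono divide_right_mono) auto
  ultimately show thesis
    using that[OF u] S_inf_le_energy[OF q u] by linarith
qed

text \<open>Replacing u by |u| keeps both power integrals and does not increase the form, by the
  reverse triangle inequality. Nonnegativity then holds at every point, not merely almost
  everywhere.\<close>

lemma nonneg_minimizer_exists: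
  fixes \<Omega> :: "'a::euclidean_space set"
  assumes s: "0 < s" and \<Omega> [measurable]: "\<Omega> \<in> sets borel" and fin: "emeasure lborel \<Omega> < \<infinity>"
    and p: "1 < p" "p < q" and ne: "admissible s p q \<Omega> \<noteq> {}"
  obtains u where "u \<in> admissible s p q \<Omega>" "energy s q u \<Omega> = S_inf s p q \<Omega>" "\<And>x. 0 \<le> u x"
proof -
  obtain u where u: "u \<in> admissible s p q \<Omega>" and e: "energy s q u \<Omega> = S_inf s p q \<Omega>"
    by (rule minimizer_exists[OF assms])
  let ?w = "\<lambda>x. \<bar>u x\<bar>"
  have uX: "u \<in> X0 s \<Omega>"
    using u by (simp add: admissible_iff[OF \<Omega>])
  have wX: "?w \<in> X0 s \<Omega>"
    by (rule X0_compose[OF uX]) (auto intro: abs_triangle_ineq3)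
  have w: "?w \<in> admissible s p q \<Omega>"
    using u wX by (simp add: admissible_iff[OF \<Omega>])
  have "gker s ?w ?w z \<le> gker s u u z" for z
  proof (cases z)
    case (Pair x y)
    have "(\<bar>u x\<bar> - \<bar>u y\<bar>)\<^sup>2 \<le> (u x - u y)\<^sup>2"
      using abs_triangle_ineq3[of "u x" "u y"] by (simp add: abs_le_square_iff)
    then show ?thesis
      by (simp add: Pair gker_def power2_eq_square divide_right_mono)
  qed
  then have "gagliardo_form s ?w ?w \<le> gagliardo_form s u u"
    unfolding gagliardo_form_gker
    by (intro integral_mono gker_integrable X0_Hs[OF uX] X0_Hs[OF wX])
  then have "energy s q ?w \<Omega> \<le> energy s q u \<Omega>"
    by (simp add: energy_X0[OF \<Omega>] uX wX)
  then show thesis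
    using that[OF w] S_inf_le_energy[OF _ w] p e by force
qed

section \<open>Boundedness and positivity\<close>

lemma nonlin_pos: "0 < t \<Longrightarrow> nonlin p q lam t = lam * t powr p - t powr q"
  using powr_add[of t "p - 1" 1] powr_add[of t "q - 1" 1] by (simp add: nonlin_def)

lemma nonlin_measurable [measurable]: "nonlin p q lam \<in> borel_measurable borel"
  unfolding nonlin_def by measurable

lemma nonlin_0 [simp]: "nonlin p q lam 0 = 0"
  by (simp add: nonlin_def)

text \<open>For t > 0 the nonlinearity factors as t^p (lam - t^{q-p}), with positive zero K. The
  sign above K drives the sup bound, the sign below K makes the solution a supersolution.\<close>

lemma nonlin_sign:
  assumes "p < q" "0 < lam"
  defines "K \<equiv> lam powr (1 / (q - p))"
  shows "0 \<le> t \<Longrightarrow> t \<le> K \<Longrightarrow> 0 \<le> nonlin p q lam t"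
    and "K < t \<Longrightarrow> nonlin p q lam t < 0"
proof -
  have K: "0 < K" "K powr (q - p) = lam"
    using assms by (auto simp: K_def powr_powr)
  have eq: "nonlin p q lam t = t powr p * (lam - t powr (q - p))" if "0 < t"
    using that powr_add[of t p "q - p"] by (simp add: nonlin_pos algebra_simps)
  show "0 \<le> nonlin p q lam t" if t: "0 \<le> t" "t \<le> K"
  proof (cases "t = 0")
    case False
    have "t powr (q - p) \<le> K powr (q - p)"
      using t assms by (intro powr_mono2) auto
    then show ?thesis using eq K t False by simp
  qed simp
  show "nonlin p q lam t < 0" if t: "K < t"
  proof -
    have "K powr (q - p) < t powr (q - p)"
      using t assms K by (intro powr_less_mono2) auto
    then show ?thesis
      using eq K t by (simp add: mult_pos_neg)
  qed
qed

text \<open>The truncation is a nondecreasing function of u, so the form against it has a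
  nonnegative integrand; the right-hand side has a nonpositive one, negative where u > K. Hence that
  set is null. The truncation lies between 0 and u, which keeps it in L^{q+1}.\<close>

lemma nonneg_solution_bounded:
  fixes u :: "'a::euclidean_space \<Rightarrow> real"
  assumes p: "p < q" "0 < q" and lam: "0 < lam"
    and uX: "u \<in> X0 s \<Omega>" and iu: "integrable lborel (\<lambda>x. \<bar>u x\<bar> powr (q + 1))" and u0: "\<And>x. 0 \<le> u x"
    and EL: "\<And>\<phi>. \<phi> \<in> X0 s \<Omega> \<Longrightarrow> integrable lborel (\<lambda>x. \<bar>\<phi> x\<bar> powr (q + 1)) \<Longrightarrow>
      integrable lborel (\<lambda>x. nonlin p q lam (u x) * \<phi> x) \<and>
      gagliardo_form s u \<phi> = (LINT x|lborel. nonlin p q lam (u x) * \<phi> x)"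
  shows "AE x in lborel. u x \<le> lam powr (1 / (q - p))"
proof -
  define K where "K = lam powr (1 / (q - p))"
  have K0: "0 \<le> K" by (simp add: K_def)
  let ?\<phi> = "\<lambda>x. max 0 (u x - K)"
  have [measurable]: "u \<in> borel_measurable lborel" using X0_measurable[OF uX] .
  have X: "?\<phi> \<in> X0 s \<Omega>"
    by (rule X0_compose[OF uX, where T = "\<lambda>t. max 0 (t - K)"]) (use K0 in auto)
  have i: "integrable lborel (\<lambda>x. \<bar>?\<phi> x\<bar> powr (q + 1))"
    by (rule Bochner_Integration.integrable_bound[OF iu])
      (use u0 K0 p in \<open>auto intro!: powr_mono2\<close>)
  note E = EL[OF X i]
  have "0 \<le> gker s u ?\<phi> z" for z
  proof (cases z)
    case (Pair x y)
    have "0 \<le> (u x - u y) * (?\<phi> x - ?\<phi> y)"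
      by (cases "u x \<le> u y") (auto simp: mult_nonpos_nonpos)
    then show ?thesis by (simp add: Pair gker_def)
  qed
  then have "0 \<le> (LINT x|lborel. nonlin p q lam (u x) * ?\<phi> x)"
    using E by (simp add: gagliardo_form_gker Bochner_Integration.integral_nonneg flip:
      conjunct2[OF E])
  then have le: "(LINT x|lborel. - (nonlin p q lam (u x) * ?\<phi> x)) \<le> 0"
    by simp
  have sgn: "0 \<le> - (nonlin p q lam (u x) * ?\<phi> x)" for x
    using nonlin_sign(2)[OF p(1) lam, of "u x"] by (cases "K < u x") (auto simp: K_def
      mult_nonpos_nonneg)
  have "(LINT x|lborel. - (nonlin p q lam (u x) * ?\<phi> x)) = 0"
    using le sgn by (intro antisym Bochner_Integration.integral_nonneg)
  then have "AE x in lborel. - (nonlin p q lam (u x) * ?\<phi> x) = 0"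
    using E sgn by (subst (asm) integral_nonneg_eq_0_iff_AE) auto
  then show ?thesis
    unfolding K_def[symmetric]
  proof eventually_elim
    case (elim x)
    then show ?case
      using nonlin_sign(2)[OF p(1) lam, of "u x"] by (cases "K < u x") (auto simp: K_def[symmetric])
  qed
qed

text \<open>
  For bounded \<open>u\<close>, the weak formulation extends from \<open>X\<^sub>0 \<inter> L\<^bsup>q+1\<^esup>\<close> to all of \<open>X\<^sub>0\<close> by truncating
  the test function.
\<close>

lemma weak_form_all_tests:
  fixes u \<phi> :: "'a::euclidean_space \<Rightarrow> real"
  assumes \<Omega> [measurable]: "\<Omega> \<in> sets borel" and fin: "emeasure lborel \<Omega> < \<infinity>" and q: "0 < q"
    and uX: "u \<in> X0 s \<Omega>" and [measurable]: "g \<in> borel_measurable borel"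
    and bound: "AE x in lborel. \<bar>g (u x)\<bar> \<le> B"
    and EL: "\<And>\<phi>. \<phi> \<in> X0 s \<Omega> \<Longrightarrow> integrable lborel (\<lambda>x. \<bar>\<phi> x\<bar> powr (q + 1)) \<Longrightarrow>
      gagliardo_form s u \<phi> = (LINT x|lborel. g (u x) * \<phi> x)"
    and \<phi>: "\<phi> \<in> X0 s \<Omega>"
  shows "integrable lborel (\<lambda>x. g (u x) * \<phi> x)"
    and "gagliardo_form s u \<phi> = (LINT x|lborel. g (u x) * \<phi> x)"
proof -
  note [measurable] = X0_measurable[OF uX] X0_measurable[OF \<phi>]
  \<comment> \<open>Clipping to [-n,n] gives bounded test functions, hence functions in L^{q+1}, and
    is 1-Lipschitz, so the clipped Gagliardo integrands are dominated by the absolute value of the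
    original one.\<close>
  define T where "T n t = max (- real n) (min t (real n))" for n t
  have Tlip: "\<bar>T n a - T n b\<bar> \<le> \<bar>a - b\<bar>" and T0: "T n 0 = 0" and Tb: "\<bar>T n a\<bar> \<le> real n"
    and Ta: "\<bar>T n a\<bar> \<le> \<bar>a\<bar>" for n a b
    by (auto simp: T_def)
  have [measurable]: "T n \<in> borel_measurable borel" for n unfolding T_def by measurable
  have Tlim: "(\<lambda>n. T n a) \<longlonglongrightarrow> a" for a
  proof (rule tendsto_eventually)
    show "\<forall>\<^sub>F n in sequentially. T n a = a"
      using eventually_ge_at_top[of "nat \<lceil>\<bar>a\<bar>\<rceil>"]
      by eventually_elim (auto simp: T_def nat_le_iff ceiling_le_iff)
  qed
  have TX: "(\<lambda>x. T n (\<phi> x)) \<in> X0 s \<Omega>" for n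
    by (rule X0_compose[OF \<phi> _ T0 Tlip]) measurable
  have Teq: "gagliardo_form s u (\<lambda>x. T n (\<phi> x)) = (LINT x|lborel. g (u x) * T n (\<phi> x))" for n
    by (rule EL[OF TX X0_bounded_integrable_powr[OF TX \<Omega> fin Tb]]) (use q in simp)
  have i1: "integrable lborel (\<lambda>x. \<bar>\<phi> x\<bar>)"
  proof -
    have i2: "integrable lborel (\<lambda>x. \<bar>\<phi> x\<bar> powr 2)"
      using X0_Hs[OF \<phi>] by (simp add: Hs_iff)
    show ?thesis
      using X0_integrable_powr[OF \<phi> \<phi> \<Omega> fin i2, of 1] by simp
  qed
  then have iB: "integrable lborel (\<lambda>x. B * \<bar>\<phi> x\<bar>)" by simp
  have b1: "AE x in lborel. norm (g (u x) * T n (\<phi> x)) \<le> B * \<bar>\<phi> x\<bar>" for n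
    using bound by eventually_elim (use Ta in \<open>auto simp: abs_mult intro!: mult_mono\<close>)
  have l1: "AE x in lborel. (\<lambda>n. g (u x) * T n (\<phi> x)) \<longlonglongrightarrow> g (u x) * \<phi> x"
    by (intro AE_I2 tendsto_mult tendsto_const Tlim)
  show "integrable lborel (\<lambda>x. g (u x) * \<phi> x)"
    by (rule integrable_dominated_convergence[OF _ _ iB l1 b1]) measurable
  have r: "(\<lambda>n. LINT x|lborel. g (u x) * T n (\<phi> x)) \<longlonglongrightarrow> (LINT x|lborel. g (u x) * \<phi> x)"
    by (rule integral_dominated_convergence[OF _ _ iB l1 b1]) measurable
  have iG: "integrable (lborel \<Otimes>\<^sub>M lborel) (\<lambda>z. \<bar>gker s u \<phi> z\<bar>)"
    using gker_integrable[OF X0_Hs[OF uX] X0_Hs[OF \<phi>]] by simp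
  have l2: "AE z in lborel \<Otimes>\<^sub>M lborel. (\<lambda>n. gker s u (\<lambda>x. T n (\<phi> x)) z) \<longlonglongrightarrow> gker s u \<phi> z"
    unfolding gker_def case_prod_beta divide_inverse
    by (intro AE_I2 tendsto_mult tendsto_diff tendsto_const Tlim)
  have b2: "AE z in lborel \<Otimes>\<^sub>M lborel. norm (gker s u (\<lambda>x. T n (\<phi> x)) z) \<le> \<bar>gker s u \<phi> z\<bar>" for n
    unfolding gker_def case_prod_beta
    by (intro AE_I2) (auto simp: abs_mult intro!: divide_right_mono mult_left_mono Tlip)
  have "(\<lambda>n. gagliardo_form s u (\<lambda>x. T n (\<phi> x))) \<longlonglongrightarrow> gagliardo_form s u \<phi>"
    unfolding gagliardo_form_gker
    by (rule integral_dominated_convergence[OF _ _ iG l2 b2]) measurable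
  then show "gagliardo_form s u \<phi> = (LINT x|lborel. g (u x) * \<phi> x)"
    unfolding Teq using r LIMSEQ_unique by blast
qed

text \<open>
  Strong maximum principle. Testing with \<open>\<eta> \<psi>\<^sub>n(u)\<close>, where \<open>\<psi>\<^sub>n\<close> decreases to the indicator of
  \<open>{0}\<close>, yields in the limit \<open>\<integral>\<integral> u(x) 1\<^bsub>u(y)=0\<^esub> \<eta>(y) |x - y|\<^bsup>-N-2s\<^esup> \<le> 0\<close>.
\<close>

lemma nonlocal_strong_maximum_principle:
  fixes u \<eta> :: "'a::euclidean_space \<Rightarrow> real"
  assumes uX: "u \<in> X0 s \<Omega>" and u0: "\<And>x. 0 \<le> u x" and nz: "\<not> (AE x in lborel. u x = 0)"
    and \<eta>X: "\<eta> \<in> X0 s \<Omega>" and \<eta>0: "\<And>x. 0 \<le> \<eta> x" and \<eta>B: "\<And>x. \<eta> x \<le> B"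
    and \<eta>pos: "\<And>x. 0 < \<eta> x \<longleftrightarrow> x \<in> \<Omega>"
    and super: "\<And>\<phi>. \<phi> \<in> X0 s \<Omega> \<Longrightarrow> (\<And>x. 0 \<le> \<phi> x) \<Longrightarrow> 0 \<le> gagliardo_form s u \<phi>"
  shows "AE x in lborel. x \<in> \<Omega> \<longrightarrow> 0 < u x"
proof -
  let ?a = "real DIM('a) + 2 * s"
  note [measurable] = X0_measurable[OF uX] X0_measurable[OF \<eta>X]
  have B0: "0 \<le> B" using \<eta>0 \<eta>B order_trans by blast
  \<comment> \<open>Nonincreasing, which fixes the sign of \<open>L\<close> below, and Lipschitz for
    each n; the constant n + 1 may grow since no estimate uniform in n uses it.\<close>
  define \<psi> where "\<psi> n t = max 0 (1 - real (Suc n) * t)" for n t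
  have \<psi>b: "0 \<le> \<psi> n t" "0 \<le> t \<Longrightarrow> \<psi> n t \<le> 1" for n t
    by (auto simp: \<psi>_def)
  have \<psi>lip: "\<bar>\<psi> n a - \<psi> n b\<bar> \<le> real (Suc n) * \<bar>a - b\<bar>" for n a b
  proof -
    have "\<bar>\<psi> n a - \<psi> n b\<bar> \<le> \<bar>real (Suc n) * a - real (Suc n) * b\<bar>"
      by (auto simp: \<psi>_def)
    also have "\<dots> = real (Suc n) * \<bar>a - b\<bar>"
      by (simp only: abs_mult right_diff_distrib[symmetric] abs_of_nat)
    finally show ?thesis .
  qed
  have \<psi>mono: "0 \<le> (a - b) * (\<psi> n b - \<psi> n a)" for a b n
  proof -
    have m: "\<psi> n c \<ge> \<psi> n d" if "c \<le> d" for c d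
      using mult_left_mono[OF that, of "real (Suc n)"] unfolding \<psi>_def by linarith
    show ?thesis
      using m[of a b] m[of b a] by (cases "a \<le> b") (auto simp: mult_nonpos_nonpos)
  qed
  have [measurable]: "\<psi> n \<in> borel_measurable borel" for n unfolding \<psi>_def by measurable
  define Z :: "real \<Rightarrow> real" where "Z t = indicator {0} t" for t
  have [measurable]: "Z \<in> borel_measurable borel" unfolding Z_def by measurable
  have Z0: "0 \<le> Z t" and Zm: "t * Z t = 0" for t by (auto simp: Z_def indicator_def)
  have \<psi>lim: "(\<lambda>n. \<psi> n t) \<longlonglongrightarrow> Z t" if "0 \<le> t" for t
  proof (cases "t = 0")
    case True then show ?thesis by (simp add: \<psi>_def Z_def)
  next
    case False
    with that have t: "0 < t" by simp
    have "\<forall>\<^sub>F n in sequentially. \<psi> n t = Z t"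
      using eventually_ge_at_top[of "nat \<lceil>1 / t\<rceil>"]
    proof eventually_elim
      case (elim n)
      then have "1 / t \<le> real n" by (simp add: nat_le_iff ceiling_le_iff)
      then have "1 \<le> real (Suc n) * t" using t by (simp add: field_simps)
      then show ?case using t by (simp add: \<psi>_def Z_def)
    qed
    then show ?thesis by (rule tendsto_eventually)
  qed
  let ?\<phi> = "\<lambda>n x. \<eta> x * \<psi> n (u x)"
  have \<phi>X: "?\<phi> n \<in> X0 s \<Omega>" for n
  proof -
    \<comment> \<open>By the product rule for differences, with
      \<open>\<psi> n (u x) \<le> 1\<close> and \<eta> \<le> B, the product is dominated by \<eta>
      and B (n+1) u.\<close>
    have "?\<phi> n \<in> Hs s"
    proof (rule Hs_dominated[OF _ X0_Hs[OF \<eta>X] Hs_scale[OF X0_Hs[OF uX], of "B * real (Suc n)"]])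
      show "\<bar>?\<phi> n x\<bar> \<le> \<bar>\<eta> x\<bar> + \<bar>B * real (Suc n) * u x\<bar>" for x
      proof -
        have "\<eta> x * \<psi> n (u x) \<le> \<eta> x * 1" using \<eta>0 \<psi>b u0 by (intro mult_left_mono) auto
        then show ?thesis using \<eta>0[of x] \<psi>b(1)[of n "u x"] by simp
      qed
      show "\<bar>?\<phi> n x - ?\<phi> n y\<bar> \<le> \<bar>\<eta> x - \<eta> y\<bar> + \<bar>B * real (Suc n) * u x - B * real (Suc n) * u y\<bar>"
        for x y
      proof -
        have "?\<phi> n x - ?\<phi> n y = (\<eta> x - \<eta> y) * \<psi> n (u y) + \<eta> x * (\<psi> n (u x) - \<psi> n (u y))"
          by (simp add: algebra_simps)
        then have "\<bar>?\<phi> n x - ?\<phi> n y\<bar> \<le> \<bar>\<eta> x - \<eta> y\<bar> * \<psi> n (u y) + \<eta> x * \<bar>\<psi> n (u x) - \<psi> n (u y)\<bar>"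
          using abs_triangle_ineq[of "(\<eta> x - \<eta> y) * \<psi> n (u y)" "\<eta> x * (\<psi> n (u x) - \<psi> n (u y))"]
            \<eta>0[of x] \<psi>b(1)[of n "u y"] by (simp add: abs_mult)
        also have "\<dots> \<le> \<bar>\<eta> x - \<eta> y\<bar> * 1 + B * (real (Suc n) * \<bar>u x - u y\<bar>)"
          using \<eta>0 \<eta>B \<psi>b u0 B0 \<psi>lip by (intro add_mono mult_mono) auto
        also have "B * (real (Suc n) * \<bar>u x - u y\<bar>) = \<bar>B * real (Suc n) * u x - B * real (Suc n) *
          u y\<bar>"
          using B0 by (simp only: abs_mult right_diff_distrib[symmetric] abs_of_nonneg abs_of_nat
            mult.assoc)
        finally show ?thesis by simp
      qed
    qed measurable
    then show ?thesis
      using X0_zero[OF \<eta>X] by (auto simp: X0_def)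
  qed
  let ?n = "\<lambda>z. norm (fst z - snd z :: 'a) powr ?a"
  \<comment> \<open>The product rule splits the Gagliardo integrand into \<open>R n - L n\<close>:
    \<open>R n\<close> carries the difference of \<eta>, \<open>L n\<close> that of
    \<open>\<psi> n\<close> and is nonnegative. The primed and unprimed limits \<open>R'\<close>,
    \<open>A\<close>, \<open>A'\<close>, \<open>D\<close> have \<open>\<psi> n\<close> replaced by
    the indicator \<open>Z\<close> of 0.\<close>
  define L where "L n z = (u (fst z) - u (snd z)) * (\<psi> n (u (snd z)) - \<psi> n (u (fst z))) * \<eta> (fst
    z) / ?n z" for n z
  define R where "R n z = (u (fst z) - u (snd z)) * (\<eta> (fst z) - \<eta> (snd z)) * \<psi> n (u (snd z)) / ?n
    z" for n z
  define R' where "R' z = (u (fst z) - u (snd z)) * (\<eta> (fst z) - \<eta> (snd z)) * Z (u (snd z)) / ?n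
    z" for z
  define A where "A z = u (fst z) * Z (u (snd z)) * \<eta> (fst z) / ?n z" for z
  define A' where "A' z = u (snd z) * Z (u (fst z)) * \<eta> (fst z) / ?n z" for z
  define D where "D z = u (fst z) * Z (u (snd z)) * \<eta> (snd z) / ?n z" for z
  have [measurable]: "L n \<in> borel_measurable (lborel \<Otimes>\<^sub>M lborel)" "R n \<in> borel_measurable (lborel
    \<Otimes>\<^sub>M lborel)"
    "R' \<in> borel_measurable (lborel \<Otimes>\<^sub>M lborel)" "A \<in> borel_measurable (lborel \<Otimes>\<^sub>M lborel)"
    "A' \<in> borel_measurable (lborel \<Otimes>\<^sub>M lborel)" "D \<in> borel_measurable (lborel \<Otimes>\<^sub>M lborel)" for n
    unfolding L_def R_def R'_def A_def A'_def D_def by measurable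
  have L0: "0 \<le> L n z" for n z
    unfolding L_def by (intro divide_nonneg_nonneg mult_nonneg_nonneg[OF \<psi>mono \<eta>0]) simp
  have nonneg: "0 \<le> A z" "0 \<le> A' z" "0 \<le> D z" for z
    unfolding A_def A'_def D_def using u0 Z0 \<eta>0 by auto
  have split: "gker s u (?\<phi> n) z = R n z - L n z" for n z
    by (cases z) (simp add: gker_def R_def L_def algebra_simps flip: add_divide_distrib
      diff_divide_distrib)
  have iG: "integrable (lborel \<Otimes>\<^sub>M lborel) (\<lambda>z. \<bar>gker s u \<eta> z\<bar>)"
    using gker_integrable[OF X0_Hs[OF uX] X0_Hs[OF \<eta>X]] by simp
  have Rb: "norm (R n z) \<le> \<bar>gker s u \<eta> z\<bar>" for n z
  proof -
    have "\<bar>(u (fst z) - u (snd z)) * (\<eta> (fst z) - \<eta> (snd z))\<bar> * \<psi> n (u (snd z))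
        \<le> \<bar>(u (fst z) - u (snd z)) * (\<eta> (fst z) - \<eta> (snd z))\<bar> * 1"
      using \<psi>b u0 by (intro mult_left_mono) auto
    then have "\<bar>(u (fst z) - u (snd z)) * (\<eta> (fst z) - \<eta> (snd z))\<bar> * \<psi> n (u (snd z)) / ?n z
        \<le> \<bar>(u (fst z) - u (snd z)) * (\<eta> (fst z) - \<eta> (snd z))\<bar> / ?n z"
      by (intro divide_right_mono) auto
    then show ?thesis
      using \<psi>b(1) by (simp add: R_def gker_def case_prod_beta abs_mult)
  qed
  have Rlim: "(\<lambda>n. R n z) \<longlonglongrightarrow> R' z" for z
    unfolding R_def R'_def divide_inverse by (intro tendsto_mult tendsto_const \<psi>lim u0)
  have iR: "integrable (lborel \<Otimes>\<^sub>M lborel) (R n)" for n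
    by (rule Bochner_Integration.integrable_bound[OF iG]) (use Rb in auto)
  have iR': "integrable (lborel \<Otimes>\<^sub>M lborel) R'"
    by (rule integrable_dominated_convergence[OF _ _ iG AE_I2[OF Rlim] AE_I2[OF Rb]]) measurable
  have Rint: "(\<lambda>n. integral\<^sup>L (lborel \<Otimes>\<^sub>M lborel) (R n)) \<longlonglongrightarrow> integral\<^sup>L (lborel \<Otimes>\<^sub>M lborel) R'"
    by (rule integral_dominated_convergence[OF _ _ iG AE_I2[OF Rlim] AE_I2[OF Rb]]) measurable
  have i\<phi>: "integrable (lborel \<Otimes>\<^sub>M lborel) (gker s u (?\<phi> n))" for n
    by (rule gker_integrable[OF X0_Hs[OF uX] X0_Hs[OF \<phi>X]])
  have iL: "integrable (lborel \<Otimes>\<^sub>M lborel) (L n)" for n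
  proof -
    have "L n = (\<lambda>z. R n z - gker s u (?\<phi> n) z)" by (simp add: split)
    then show ?thesis using Bochner_Integration.integrable_diff[OF iR i\<phi>] by simp
  qed
  have Lle: "integral\<^sup>L (lborel \<Otimes>\<^sub>M lborel) (L n) \<le> integral\<^sup>L (lborel \<Otimes>\<^sub>M lborel) (R n)" for n
  proof -
    have "0 \<le> gagliardo_form s u (?\<phi> n)"
      using \<eta>0 \<psi>b by (intro super \<phi>X) auto
    then show ?thesis
      unfolding gagliardo_form_gker split using iR iL by simp
  qed
  have Llim: "(\<lambda>n. L n z) \<longlonglongrightarrow> A z + A' z" for z
  proof -
    have "(\<lambda>n. L n z) \<longlonglongrightarrow> (u (fst z) - u (snd z)) * (Z (u (snd z)) - Z (u (fst z))) * \<eta> (fst z) / ?n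
      z"
      unfolding L_def divide_inverse by (intro tendsto_mult tendsto_diff tendsto_const \<psi>lim u0)
    also have "(u (fst z) - u (snd z)) * (Z (u (snd z)) - Z (u (fst z)))
        = u (fst z) * Z (u (snd z)) + u (snd z) * Z (u (fst z))"
      by (simp add: Zm algebra_simps)
    finally show ?thesis by (simp add: A_def A'_def distrib_right add_divide_distrib)
  qed
  have mAA: "(\<lambda>z. A z + A' z) \<in> borel_measurable (lborel \<Otimes>\<^sub>M lborel)" by measurable
  \<comment> \<open>For \<open>R n\<close> the integrand against \<eta> is a majorant; for
    \<open>L n\<close> only the sign is available, hence Fatou's lemma. It also supplies the
    integrability of \<open>A\<close> on which the cancellation below rests.\<close>
  note F = Fatou_integral_le[OF iL L0 mAA AE_I2[OF Llim] Lle Rint]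
  have iA: "integrable (lborel \<Otimes>\<^sub>M lborel) A" and iA': "integrable (lborel \<Otimes>\<^sub>M lborel) A'"
    by (auto intro!: Bochner_Integration.integrable_bound[OF F(1)] simp: nonneg)
  \<comment> \<open>The integral of \<open>A + A'\<close> is at most that of \<open>R'\<close>,
    which is \<open>A - D\<close>. Cancelling \<open>A\<close> leaves a nonpositive integral of
    \<open>A' + D\<close>, and both summands are nonnegative.\<close>
  have D: "D z = A z - R' z" for z
  proof -
    have "(u (fst z) - u (snd z)) * (\<eta> (fst z) - \<eta> (snd z)) * Z (u (snd z))
        = u (fst z) * Z (u (snd z)) * (\<eta> (fst z) - \<eta> (snd z))"
    proof -
      have "(p - q) * r * c = p * c * r - q * c * r" for p q r c :: real
        by (simp add: algebra_simps)
      then show ?thesis by (simp add: Zm)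
    qed
    then show ?thesis
      by (simp add: D_def A_def R'_def right_diff_distrib diff_divide_distrib)
  qed
  have iD: "integrable (lborel \<Otimes>\<^sub>M lborel) D"
    using Bochner_Integration.integrable_diff[OF iA iR'] by (simp add: D[abs_def])
  have "integral\<^sup>L (lborel \<Otimes>\<^sub>M lborel) D = integral\<^sup>L (lborel \<Otimes>\<^sub>M lborel) A - integral\<^sup>L (lborel
    \<Otimes>\<^sub>M lborel) R'"
    using iA iR' by (simp add: D[abs_def])
  moreover have "0 \<le> integral\<^sup>L (lborel \<Otimes>\<^sub>M lborel) A'" "0 \<le> integral\<^sup>L (lborel \<Otimes>\<^sub>M lborel) D"
    by (auto intro!: Bochner_Integration.integral_nonneg nonneg)
  ultimately have "integral\<^sup>L (lborel \<Otimes>\<^sub>M lborel) D = 0"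
    using F(2) iA iA' by simp
  then have "AE z in lborel \<Otimes>\<^sub>M lborel. D z = 0"
    using iD nonneg by (subst (asm) integral_nonneg_eq_0_iff_AE) auto
  then have "AE x in lborel. AE y in lborel. D (x, y) = 0"
    by (rule lborel_pair.AE_pair)
  \<comment> \<open>The kernel is positive at all pairs of distinct points, so one suitable x with
    u(x) > 0 reaches almost every y.\<close>
  moreover have "\<exists>x. u x \<noteq> 0 \<and> (AE y in lborel. D (x, y) = 0)" if "AE x in lborel. AE y in lborel.
    D (x, y) = 0"
  proof (rule ccontr)
    assume "\<not> ?thesis"
    with that have "AE x in lborel. u x = 0"
      by (auto elim: eventually_mono)
    with nz show False by simp
  qed
  ultimately obtain x where x: "u x \<noteq> 0" "AE y in lborel. D (x, y) = 0"
    by blast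
  \<comment> \<open>On the diagonal the quotient is 0 by the convention for division by zero and
    carries no information.\<close>
  have "AE y in lborel. y \<noteq> x"
    by (rule AE_lborel_singleton)
  with x(2) show ?thesis
  proof eventually_elim
    case (elim y)
    then have "Z (u y) * \<eta> y = 0"
      using x(1) by (auto simp: D_def)
    then show ?case
      using \<eta>pos[of y] u0[of y] by (auto simp: Z_def indicator_def split: if_splits)
  qed
qed

section \<open>Rescaling and conclusion\<close>

lemma positive_weak_solution_rescaled:
  fixes w :: "'a::euclidean_space \<Rightarrow> real"
  assumes \<Omega> [measurable]: "\<Omega> \<in> sets borel" and p: "1 < p" and lam: "0 < lam"
    and w: "positive_weak_solution s q \<Omega> (nonlin p q lam) w"
  defines "\<Lambda> \<equiv> lam powr (1 / (p - 1))" and "c \<equiv> lam powr (- (q - 1) / (p - 1))"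
  shows "weak_solution s q \<Omega> (\<lambda>t. t powr p - c * t powr q) (\<lambda>x. \<Lambda> * w x)"
proof -
  have ws: "weak_solution s q \<Omega> (nonlin p q lam) w" and pos: "AE x in lborel. x \<in> \<Omega> \<longrightarrow> 0 < w x"
    using w by (auto simp: positive_weak_solution_def)
  have wX: "w \<in> X0 s \<Omega>" and wL: "w \<in> Lspace (q + 1) \<Omega>"
    using ws by (auto simp: weak_solution_def)
  have \<Lambda>: "0 < \<Lambda>" using lam by (simp add: \<Lambda>_def)
  have UX: "(\<lambda>x. \<Lambda> * w x) \<in> X0 s \<Omega>" by (rule X0_scale[OF wX])
  have UL: "(\<lambda>x. \<Lambda> * w x) \<in> Lspace (q + 1) \<Omega>"
    using wL X0_Lspace_iff[OF wX \<Omega>, of "q + 1"] X0_Lspace_iff[OF UX \<Omega>, of "q + 1"]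
    by (simp add: abs_mult powr_mult)
  \<comment> \<open>The identities \<Lambda>^p = lam \<Lambda> and c \<Lambda>^q = \<Lambda> are the
    equations that determine \<Lambda> and c; positivity of t removes the absolute values in
    \<open>nonlin\<close>.\<close>
  have scale: "(\<Lambda> * t) powr p - c * (\<Lambda> * t) powr q = \<Lambda> * nonlin p q lam t" if "0 < t" for t
  proof -
    have e1: "\<Lambda> powr p = \<Lambda> * lam"
    proof -
      have "\<Lambda> powr p = \<Lambda> powr (1 + (p - 1))" by simp
      also have "\<dots> = \<Lambda> * \<Lambda> powr (p - 1)" using \<Lambda> by (simp only: powr_add powr_one less_imp_le)
      also have "\<Lambda> powr (p - 1) = lam" using p lam by (simp add: \<Lambda>_def powr_powr)
      finally show ?thesis .
    qed
    have e2: "c * \<Lambda> powr q = \<Lambda>"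
    proof -
      have "- (q - 1) / (p - 1) + q / (p - 1) = 1 / (p - 1)"
        using p by (simp flip: add_divide_distrib)
      then show ?thesis
        by (simp add: c_def \<Lambda>_def powr_powr flip: powr_add)
    qed
    have "(\<Lambda> * t) powr p - c * (\<Lambda> * t) powr q = \<Lambda> powr p * t powr p - (c * \<Lambda> powr q) * t powr q"
      using \<Lambda> that by (simp add: powr_mult)
    then show ?thesis
      using that by (simp add: e1 e2 nonlin_pos right_diff_distrib)
  qed
  show ?thesis
    unfolding weak_solution_def
  proof (intro conjI IntI UX UL ballI)
    fix \<phi> assume \<phi>: "\<phi> \<in> X0 s \<Omega>"
    let ?g = "\<lambda>x. (\<Lambda> * w x) powr p - c * (\<Lambda> * w x) powr q"
    note [measurable] = X0_measurable[OF wX] X0_measurable[OF \<phi>]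
    have i: "set_integrable lborel \<Omega> (\<lambda>x. nonlin p q lam (w x) * \<phi> x)"
      and e: "gagliardo_form s w \<phi> = (LINT x:\<Omega>|lborel. nonlin p q lam (w x) * \<phi> x)"
      using ws \<phi> by (auto simp: weak_solution_def)
    \<comment> \<open>The two nonlinearities are matched where w > 0, that is, almost everywhere in
      \<Omega>.\<close>
    have ae: "AE x in lborel. indicator \<Omega> x *\<^sub>R (?g x * \<phi> x) = \<Lambda> * (indicator \<Omega> x *\<^sub>R (nonlin p q
      lam (w x) * \<phi> x))"
      using pos by eventually_elim (auto simp: indicator_def scale)
    show "set_integrable lborel \<Omega> (\<lambda>x. ?g x * \<phi> x)"
      unfolding set_integrable_def
      by (subst integrable_cong_AE[OF _ _ ae])
        (use i in \<open>auto simp: set_integrable_def\<close>)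
    have "(LINT x:\<Omega>|lborel. ?g x * \<phi> x) = \<Lambda> * (LINT x:\<Omega>|lborel. nonlin p q lam (w x) * \<phi> x)"
      unfolding set_lebesgue_integral_def
      by (subst integral_cong_AE[OF _ _ ae]) auto
    then show "gagliardo_form s (\<lambda>x. \<Lambda> * w x) \<phi> = (LINT x:\<Omega>|lborel. ?g x * \<phi> x)"
      using gagliardo_form_scale[of s \<Lambda> w 1 \<phi>] e by simp
  qed
qed

lemma nonneg_minimizer_weak_solution:
  fixes \<Omega> :: "'a::euclidean_space set"
  assumes s: "0 < s" "s < 1" and op: "open \<Omega>" and bd: "bounded \<Omega>" and ne: "\<Omega> \<noteq> {}"
    and p: "1 < p" "p < q"
  obtains u lam where "u \<in> admissible s p q \<Omega>" "energy s q u \<Omega> = S_inf s p q \<Omega>" "0 < lam"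
    "positive_weak_solution s q \<Omega> (nonlin p q lam) u"
proof -
  have \<Omega>: "\<Omega> \<in> sets borel" using op by simp
  have fin: "emeasure lborel \<Omega> < \<infinity>" by (rule emeasure_bounded_finite[OF bd])
  obtain u where u: "u \<in> admissible s p q \<Omega>" and e: "energy s q u \<Omega> = S_inf s p q \<Omega>" and u0: "\<And>x.
    0 \<le> u x"
    by (rule nonneg_minimizer_exists[OF s(1) \<Omega> fin p])
      (use admissible_nonempty[OF s op bd ne, of p q] p in auto)
  have uX: "u \<in> X0 s \<Omega>" and iu: "integrable lborel (\<lambda>x. \<bar>u x\<bar> powr (q + 1))"
    and u1: "(LINT x|lborel. \<bar>u x\<bar> powr (p + 1)) = 1"
    using u unfolding admissible_iff[OF \<Omega>] by auto
  note [measurable] = X0_measurable[OF uX]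
  have nz: "\<not> (AE x in lborel. u x = 0)"
  proof
    assume "AE x in lborel. u x = 0"
    then have "(LINT x|lborel. \<bar>u x\<bar> powr (p + 1)) = (LINT x|(lborel :: 'a measure). 0)"
      by (intro integral_cong_AE) auto
    then show False using u1 by simp
  qed
  \<comment> \<open>Testing the equation with u, whose (p+1)-th power integrates to 1, leaves no
    other value.\<close>
  define lam where "lam = gagliardo_form s u u + (LINT x|lborel. \<bar>u x\<bar> powr (q + 1))"
  have "(LINT x|lborel. \<bar>u x\<bar> powr (q + 1)) \<noteq> 0"
    using nz by (subst integral_nonneg_eq_0_iff_AE[OF iu]) auto
  moreover have "0 \<le> (LINT x|lborel. \<bar>u x\<bar> powr (q + 1))"
    by (intro Bochner_Integration.integral_nonneg) simp
  ultimately have lam: "0 < lam"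
    using gagliardo_form_nonneg[of s u] unfolding lam_def by linarith
  have min: "energy s q u \<Omega> \<le> energy s q v \<Omega>" if "v \<in> admissible s p q \<Omega>" for v
    unfolding e using p by (intro S_inf_le_energy that) simp
  have EL: "integrable lborel (\<lambda>x. nonlin p q lam (u x) * \<phi> x) \<and>
      gagliardo_form s u \<phi> = (LINT x|lborel. nonlin p q lam (u x) * \<phi> x)"
    if "\<phi> \<in> X0 s \<Omega>" "integrable lborel (\<lambda>x. \<bar>\<phi> x\<bar> powr (q + 1))" for \<phi>
    using euler_lagrange[OF \<Omega> fin _ p(2) u min that lam_def] p by simp
  define K where "K = lam powr (1 / (q - p))"
  have uK: "AE x in lborel. u x \<le> K"
    unfolding K_def by (rule nonneg_solution_bounded[OF p(2) _ lam uX iu u0 EL]) (use p in auto)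
  have gb: "AE x in lborel. \<bar>nonlin p q lam (u x)\<bar> \<le> lam * K powr p + K powr q"
    using uK
  proof eventually_elim
    case (elim x)
    show ?case
    proof (cases "u x = 0")
      case False
      then have "0 < u x" using u0[of x] by simp
      moreover have "lam * u x powr p \<le> lam * K powr p" "u x powr q \<le> K powr q"
        using elim u0[of x] p lam by (auto intro!: powr_mono2)
      moreover have "0 \<le> lam * u x powr p" "0 \<le> u x powr q" using lam by auto
      ultimately show ?thesis
        unfolding nonlin_pos[OF \<open>0 < u x\<close>] by linarith
    qed (use lam in simp)
  qed
  have weak: "integrable lborel (\<lambda>x. nonlin p q lam (u x) * \<phi> x)"
    "gagliardo_form s u \<phi> = (LINT x|lborel. nonlin p q lam (u x) * \<phi> x)"
    if "\<phi> \<in> X0 s \<Omega>" for \<phi>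
    using weak_form_all_tests[OF \<Omega> fin _ uX nonlin_measurable gb conjunct2[OF EL] that, of q] p by
      auto
  \<comment> \<open>Since 0 \<le> u \<le> K almost everywhere, the right-hand side is
    nonnegative.\<close>
  have super: "0 \<le> gagliardo_form s u \<phi>" if \<phi>: "\<phi> \<in> X0 s \<Omega>" and \<phi>0: "\<And>x. 0 \<le> \<phi> x" for \<phi>
    unfolding weak(2)[OF \<phi>]
  proof (rule Bochner_Integration.integral_nonneg_AE)
    show "AE x in lborel. 0 \<le> nonlin p q lam (u x) * \<phi> x"
      using uK by eventually_elim
        (use nonlin_sign(1)[OF p(2) lam] u0 \<phi>0 in \<open>auto simp: K_def\<close>)
  qed
  note \<eta> = infdist_in_X0[OF s op bd]
  obtain B where B: "\<And>x. infdist x (- \<Omega>) \<le> B" using \<eta>(2) by blast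
  have pos: "AE x in lborel. x \<in> \<Omega> \<longrightarrow> 0 < u x"
    by (rule nonlocal_strong_maximum_principle[OF uX u0 nz \<eta>(1,3) B \<eta>(4) super])
  have "weak_solution s q \<Omega> (nonlin p q lam) u"
    unfolding weak_solution_def
  proof (intro conjI IntI uX ballI)
    show "u \<in> Lspace (q + 1) \<Omega>"
      using X0_Lspace_iff[OF uX \<Omega>] iu by simp
    fix \<phi> assume \<phi>: "\<phi> \<in> X0 s \<Omega>"
    note [measurable] = X0_measurable[OF \<phi>]
    have z: "AE x in lborel. x \<notin> \<Omega> \<longrightarrow> nonlin p q lam (u x) * \<phi> x = 0"
      using X0_zero[OF \<phi>] by eventually_elim auto
    have m: "(\<lambda>x. nonlin p q lam (u x) * \<phi> x) \<in> borel_measurable lborel" by measurable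
    show "set_integrable lborel \<Omega> (\<lambda>x. nonlin p q lam (u x) * \<phi> x)"
      using weak(1)[OF \<phi>] set_integral_eq_integral(1)[OF m \<Omega> z] by simp
    show "gagliardo_form s u \<phi> = (LINT x:\<Omega>|lborel. nonlin p q lam (u x) * \<phi> x)"
      using weak(2)[OF \<phi>] set_integral_eq_integral(2)[OF m \<Omega> z] by simp
  qed
  then show thesis
    using that[OF u e lam] pos by (simp add: positive_weak_solution_def)
qed

theorem theorem1p6:
  fixes s p q :: real and \<Omega> :: "'a::euclidean_space set"
  assumes "0 < s" and "s < 1" and "real DIM('a) > 2 * s"
    and "p \<ge> crit_exp DIM('a) s - 1" and "q > p"
    and "smooth_bounded_domain \<Omega>"
  shows "\<exists>u \<in> admissible s p q \<Omega>.
    energy s q u \<Omega> = S_inf s p q \<Omega> \<and>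
    (\<exists>lam>0.
       weak_solution s q \<Omega> (nonlin p q lam) u \<and>
       (p \<ge> crit_exp DIM('a) s - 1 \<and> q > (p - 1) * real DIM('a) / (2 * s) - 1 \<longrightarrow>
          (\<exists>w. positive_weak_solution s q \<Omega> (nonlin p q lam) w) \<and>
          (\<forall>w. positive_weak_solution s q \<Omega> (nonlin p q lam) w \<longrightarrow>
             weak_solution s q \<Omega>
               (\<lambda>t. t powr p - lam powr (- (q - 1) / (p - 1)) * t powr q)
               (\<lambda>x. lam powr (1 / (p - 1)) * w x))))"
proof -
  have \<Omega>: "open \<Omega>" "bounded \<Omega>" "\<Omega> \<noteq> {}"
    using assms(6) by (auto simp: smooth_bounded_domain_def)
  \<comment> \<open>The quotient 2N/(N-2s) exceeds 2 because s > 0; this gives p > 1, so that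
    1/(p-1) is a legitimate exponent.\<close>
  have "2 < crit_exp DIM('a) s"
    using assms(1,3) by (simp add: crit_exp_def field_simps)
  then have p: "1 < p" using assms(4) by simp
  obtain u lam where u: "u \<in> admissible s p q \<Omega>" "energy s q u \<Omega> = S_inf s p q \<Omega>" "0 < lam"
    "positive_weak_solution s q \<Omega> (nonlin p q lam) u"
    by (rule nonneg_minimizer_weak_solution[OF assms(1,2) \<Omega> p assms(5)])
  have "\<Omega> \<in> sets borel" using \<Omega>(1) by simp
  note rescaled = positive_weak_solution_rescaled[OF this p u(3)]
  show ?thesis
  proof (intro bexI[OF _ u(1)] conjI exI[of _ lam] u(2,3) impI allI)
    show "weak_solution s q \<Omega> (nonlin p q lam) u"
      using u(4) by (simp add: positive_weak_solution_def)
    show "\<exists>w. positive_weak_solution s q \<Omega> (nonlin p q lam) w"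
      using u(4) by blast
  qed (rule rescaled)
qed

end
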